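(* Let $A,B$ be integers, let $A^{(i)}=(0,a_i)$ and $E^{(i)}=(B-b_i,A)$ for $i=1,\dots,n$, and let $S_k=(x_k,y_k)$ ($k=1,\dots,p$) and $T_j=(z_j,w_j)$ ($j=1,\dots,q$) be lattice points, where $a_1>\dots>a_n$, $b_1>\dots>b_n$, $0\le x_k,z_j\le B-b_n$ and $a_n\le y_k,w_j\le A$. Consider families $(P_1,\dots,P_n)$ of non-intersecting lattice paths, where $P_i$ runs from $A^{(i)}$ to $E^{(i)}$ and stays weakly south-east of every $S_k$ and weakly north-west of every $T_j$, and count the total number of NE-turns of the family, where a NE-turn of $P_i$ at a point $T_k+(-n+i,n-i)$ is not counted. The maximum of this count is $\sum_{i=1}^n t_i$, where $t_i$ is the output of the slalom algorithm (described in the context) applied with starting point $A^{(i)}$, end point $E^{(i)}$, south-east restriction points (the "$S$-points") $$\{(i-j,\,a_j-i+j):1\le j\le i-1\}\cup\{(B-b_j+i-j,\,A-i+j):1\le j\le i-1\}\cup\{S_k+(i-1,-i+1):1\le k\le p\},$$ and north-west restriction points (the "$T$-points") $\{T_k+(-n+i,\,n-i):1\le k\le q\}$.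
   Context: A lattice path is a finite sequence of points of $\mathbb Z^2$ with each successive difference $(1,0)$ or $(0,1)$. A family of lattice paths is non-intersecting if no two have a common point. A NE-turn is a point of a path that is the end point of a step $(0,1)$ and the starting point of a step $(1,0)$. A path stays weakly south-east of $S=(s_1,s_2)$ if each of its points $(x,y)$ has $x\ge s_1$ or $y\le s_2$; it stays weakly north-west of $T=(t_1,t_2)$ if each of its points $(x,y)$ has $x\le t_1$ or $y\ge t_2$. Slalom algorithm, input a start point $\mathcal A$, end point $\mathcal B$, $S$-points $\sigma_1,\dots,\sigma_r$ and $T$-points $\tau_1,\dots,\tau_s$: (1) Let $P_1=\{\mathcal A,\mathcal B\}\cup\{\sigma_i\}\cup\{\tau_j\}$. (2) Replace each $(x,y)\in P_1$ by $(x+y,x-y)$, obtaining $P_2$; let $\hat{\mathcal A},\hat{\mathcal B}$ be the images of $\mathcal A,\mathcal B$. (3) Order $P_2$ by increasing first coordinate, ties arbitrarily, as $\hat{\mathcal A},U_1,\dots,U_{r+s},\hat{\mathcal B}$; label each $U_k$ by $S$ or $T$ according as it comes from an $S$-point or a $T$-point; label $\hat{\mathcal B}$ by both $S$ and $T$. (4) Initialise $P_3=\{\hat{\mathcal A}\}$. Scan $U_1,U_2,\dots$ until a point labelled $S$ with larger second coordinate than $\hat{\mathcal A}$, or a point labelled $T$ with smaller second coordinate than $\hat{\mathcal A}$, is found; add it to $P_3$. If it is $\hat{\mathcal B}$ go to (6), else to (5). (5) Let $C=U_k$ be the last point put into $P_3$. Continue scanning $U_{k+1},\dots$ for a point labelled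 $S$ with larger second coordinate than $C$ or a point labelled $T$ with smaller second coordinate than $C$. If $C$ is labelled $S$: in the first case replace $C$ in $P_3$ by the point found, in the second case add it to $P_3$. If $C$ is labelled $T$: in the first case add the point found, in the second case replace $C$ by it. If the point so put into $P_3$ is $\hat{\mathcal B}$ go to (6), otherwise repeat (5). (6) Writing $P_3=\{V^{(0)}=\hat{\mathcal A},V^{(1)},\dots,V^{(s')},V^{(s'+1)}=\hat{\mathcal B}\}$ in the order obtained, output $$\frac12\sum_{i=0}^{s'}\min\bigl\{V^{(i+1)}_1+V^{(i+1)}_2-V^{(i)}_1-V^{(i)}_2,\;V^{(i+1)}_1-V^{(i+1)}_2-V^{(i)}_1+V^{(i)}_2\bigr\}.$$
   Formalization: The formal theorem assumes that an admissible family exists and that step (3) of the slalom algorithm can be carried out for every i, i.e. a_1 ≤ x_k+y_k, z_j+w_j ≤ A+B−b_1; otherwise some t_i is undefined. It holds for every way of breaking ties. *)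

theory Defs
  imports Complex_Main "HOL-Library.Product_Plus"
begin

type_synonym lpoint = "int \<times> int"

definition lattice_path :: "lpoint list \<Rightarrow> bool" where
  "lattice_path p \<longleftrightarrow> p \<noteq> [] \<and>
     (\<forall>k. Suc k < length p \<longrightarrow> p ! Suc k - p ! k \<in> {(1, 0), (0, 1)})"

definition NE_turns :: "lpoint list \<Rightarrow> lpoint set" where
  "NE_turns p = {p ! Suc k | k. Suc (Suc k) < length p \<and>
     p ! Suc k - p ! k = (0, 1) \<and> p ! Suc (Suc k) - p ! Suc k = (1, 0)}"

definition weakly_SE_of :: "lpoint list \<Rightarrow> lpoint \<Rightarrow> bool" where
  "weakly_SE_of p s \<longleftrightarrow> (\<forall>(x, y) \<in> set p. x \<ge> fst s \<or> y \<le> snd s)"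

definition weakly_NW_of :: "lpoint list \<Rightarrow> lpoint \<Rightarrow> bool" where
  "weakly_NW_of p t \<longleftrightarrow> (\<forall>(x, y) \<in> set p. x \<le> fst t \<or> y \<ge> snd t)"

definition non_intersecting :: "nat \<Rightarrow> (nat \<Rightarrow> lpoint list) \<Rightarrow> bool" where
  "non_intersecting n P \<longleftrightarrow>
     (\<forall>i\<in>{1..n}. \<forall>j\<in>{1..n}. i \<noteq> j \<longrightarrow> set (P i) \<inter> set (P j) = {})"

definition path_family ::
  "nat \<Rightarrow> (nat \<Rightarrow> lpoint) \<Rightarrow> (nat \<Rightarrow> lpoint) \<Rightarrow> lpoint set \<Rightarrow> lpoint set \<Rightarrow> (nat \<Rightarrow> lpoint list) \<Rightarrow> bool"
where
  "path_family n st en Ss Ts P \<longleftrightarrow>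
     (\<forall>i\<in>{1..n}. lattice_path (P i) \<and> hd (P i) = st i \<and> last (P i) = en i \<and>
        (\<forall>s\<in>Ss. weakly_SE_of (P i) s) \<and> (\<forall>t\<in>Ts. weakly_NW_of (P i) t)) \<and>
     non_intersecting n P"

definition counted_NE_turns :: "nat \<Rightarrow> lpoint set \<Rightarrow> (nat \<Rightarrow> lpoint list) \<Rightarrow> nat" where
  "counted_NE_turns n Ts P =
     (\<Sum>i=1..n. card (NE_turns (P i) - {t + (int i - int n, int n - int i) | t. t \<in> Ts}))"


section \<open>The slalom algorithm\<close>

datatype slalom_label = S_label | T_label

definition rot :: "lpoint \<Rightarrow> lpoint" where
  "rot v = (fst v + snd v, fst v - snd v)"

text \<open>
  \<open>slalom_order \<A> \<B> Ss Ts U\<close>: the rotated points, in the order \<open>rot \<A>\<close>, \<open>U\<close>, \<open>rot \<B>\<close>, have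
  weakly increasing first coordinates. Ties may be broken in any way. No such \<open>U\<close> exists if some
  restriction point lies on an antidiagonal before that of \<open>\<A>\<close> or after that of \<open>\<B>\<close>; such points
  are not admissible input.
\<close>

definition slalom_order ::
  "lpoint \<Rightarrow> lpoint \<Rightarrow> lpoint set \<Rightarrow> lpoint set \<Rightarrow> (slalom_label \<times> lpoint) list \<Rightarrow> bool"
where
  "slalom_order \<A> \<B> Ss Ts U \<longleftrightarrow>
     distinct U \<and>
     set U = Pair S_label ` rot ` Ss \<union> Pair T_label ` rot ` Ts \<and>
     sorted (map fst (rot \<A> # map snd U @ [rot \<B>]))"

fun turns_at :: "slalom_label \<Rightarrow> lpoint \<Rightarrow> lpoint \<Rightarrow> bool" where
  "turns_at S_label C u \<longleftrightarrow> snd u > snd C"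
| "turns_at T_label C u \<longleftrightarrow> snd u < snd C"

text \<open>
  In \<open>slalom_scan V l C U b\<close>, the points collected so far are \<open>V @ [C]\<close>, where \<open>C\<close> has label \<open>l\<close>,
  and \<open>U\<close> is what remains to be scanned before \<open>b = rot \<B>\<close>. The end point carries both labels, so
  it is found as soon as its second coordinate differs from that of \<open>C\<close>, and it replaces \<open>C\<close> iff it
  is found through the label \<open>l\<close>. If the second coordinates agree, it is neither above nor below
  \<open>C\<close>, and it is added; replacing \<open>C\<close> by it would give the same output.
\<close>

fun slalom_scan ::
  "lpoint list \<Rightarrow> slalom_label \<Rightarrow> lpoint \<Rightarrow> (slalom_label \<times> lpoint) list \<Rightarrow> lpoint \<Rightarrow> lpoint list"
where
  "slalom_scan V l C [] b = (if turns_at l C b then V @ [b] else V @ [C, b])"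
| "slalom_scan V l C ((m, u) # U) b =
     (if turns_at m C u
      then (if m = l then slalom_scan V l u U b else slalom_scan (V @ [C]) m u U b)
      else slalom_scan V l C U b)"

fun slalom_points :: "lpoint \<Rightarrow> (slalom_label \<times> lpoint) list \<Rightarrow> lpoint \<Rightarrow> lpoint list" where
  "slalom_points a [] b = [a, b]"
| "slalom_points a ((m, u) # U) b =
     (if turns_at m a u then slalom_scan [a] m u U b else slalom_points a U b)"

definition slalom_value :: "lpoint list \<Rightarrow> real" where
  "slalom_value V = 1 / 2 * (\<Sum>i<length V - 1. of_int (min
       (fst (V ! Suc i) + snd (V ! Suc i) - fst (V ! i) - snd (V ! i))
       (fst (V ! Suc i) - snd (V ! Suc i) - fst (V ! i) + snd (V ! i))))"

text \<open>A relation rather than a function, because of the arbitrary choice in case of ties.\<close>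

definition slalom_output :: "lpoint \<Rightarrow> lpoint \<Rightarrow> lpoint set \<Rightarrow> lpoint set \<Rightarrow> real \<Rightarrow> bool" where
  "slalom_output \<A> \<B> Ss Ts t \<longleftrightarrow>
     (\<exists>U. slalom_order \<A> \<B> Ss Ts U \<and> t = slalom_value (slalom_points (rot \<A>) U (rot \<B>)))"

lemma slalom_output_exists_iff:
  assumes "finite Ss" "finite Ts" "fst \<A> + snd \<A> \<le> fst \<B> + snd \<B>"
  shows "(\<exists>t. slalom_output \<A> \<B> Ss Ts t) \<longleftrightarrow>
    (\<forall>v \<in> Ss \<union> Ts. fst \<A> + snd \<A> \<le> fst v + snd v \<and> fst v + snd v \<le> fst \<B> + snd \<B>)"
proof
  assume "\<exists>t. slalom_output \<A> \<B> Ss Ts t"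
  then obtain U where U: "slalom_order \<A> \<B> Ss Ts U"
    by (auto simp: slalom_output_def)
  show "\<forall>v \<in> Ss \<union> Ts. fst \<A> + snd \<A> \<le> fst v + snd v \<and> fst v + snd v \<le> fst \<B> + snd \<B>"
  proof
    fix v assume "v \<in> Ss \<union> Ts"
    then obtain l where "(l, rot v) \<in> set U"
      using U unfolding slalom_order_def by blast
    then have "fst (rot v) \<in> set (map fst (map snd U))"
      by force
    moreover have "sorted (fst (rot \<A>) # map fst (map snd U) @ [fst (rot \<B>)])"
      using U by (simp add: slalom_order_def)
    ultimately have "fst (rot \<A>) \<le> fst (rot v) \<and> fst (rot v) \<le> fst (rot \<B>)"
      unfolding sorted_simps sorted_append by (metis UnCI list.set_intros(1) set_append)
    then show "fst \<A> + snd \<A> \<le> fst v + snd v \<and> fst v + snd v \<le> fst \<B> + snd \<B>"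
      by (simp add: rot_def)
  qed
next
  assume *: "\<forall>v \<in> Ss \<union> Ts. fst \<A> + snd \<A> \<le> fst v + snd v \<and> fst v + snd v \<le> fst \<B> + snd \<B>"
  let ?X = "Pair S_label ` rot ` Ss \<union> Pair T_label ` rot ` Ts"
  have "finite ?X"
    using assms by simp
  then obtain L where L: "set L = ?X" "distinct L"
    using finite_distinct_list by metis
  define U where "U = sort_key (\<lambda>z. fst (snd z)) L"
  have "sorted (map (\<lambda>z. fst (snd z)) U)" and U: "distinct U" "set U = ?X"
    using L by (simp_all add: U_def)
  then have "sorted (map fst (map snd U))"
    by (simp add: comp_def)
  then have "slalom_order \<A> \<B> Ss Ts U"
    using * U assms(3)
    by (simp add: slalom_order_def sorted_append rot_def ball_Un image_Un image_image)
  then show "\<exists>t. slalom_output \<A> \<B> Ss Ts t"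
    by (auto simp: slalom_output_def)
qed

end

theory Submission
  imports Defs
begin

text \<open>
  In the rotated coordinates \<open>u = x + y\<close>, \<open>v = x - y\<close> a lattice path becomes a walk with steps
  \<open>\<plusminus>1\<close>, a NE-turn becomes a valley, an \<open>S\<close>-point becomes a lower and a \<open>T\<close>-point an upper bound for
  the walk at one abscissa. For a single walk, the slalom output bounds the number of counted
  valleys: on a stretch between consecutive slalom points each valley uses up one step of the rarer
  kind. Non-intersecting paths satisfy \<open>v\<^sub>i + 2 \<le> v\<^bsub>i+1\<^esub>\<close>, which is why the \<open>i\<close>-th path obeys the
  shifted restrictions, so the bounds add up.

  The bound is attained by the lazy walk, which zigzags at its current level until a restriction
  ahead forces it to climb or to descend. The rule is local, and it is monotone in the restrictions:
  at a first crossing of two consecutive lazy walks one of them would make a step that it is neither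
  forced nor inclined to make. Hence the lazy walks for \<open>i = 1, \<dots>, n\<close> do not intersect, and they are
  simultaneously optimal.
\<close>

section \<open>Walks and valleys\<close>

definition walk :: "int \<Rightarrow> int \<Rightarrow> (int \<Rightarrow> int) \<Rightarrow> bool" where
  "walk c d w \<longleftrightarrow> (\<forall>u. c \<le> u \<and> u < d \<longrightarrow> \<bar>w (u + 1) - w u\<bar> = 1)"

lemma walk_subinterval: "walk c d w \<Longrightarrow> c \<le> c' \<Longrightarrow> d' \<le> d \<Longrightarrow> walk c' d' w"
  by (auto simp: walk_def)

lemma walk_step: "walk c d w \<Longrightarrow> c \<le> u \<Longrightarrow> u < d \<Longrightarrow> w (u + 1) = w u + 1 \<or> w (u + 1) = w u - 1"
  unfolding walk_def by (smt (verit))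

lemma walk_lipschitz:
  assumes "walk c d w" "c \<le> x" "x \<le> y" "y \<le> d"
  shows "\<bar>w y - w x\<bar> \<le> y - x"
  using assms(3,4)
proof (induction y rule: int_ge_induct)
  case (step y)
  then show ?case using walk_step[OF assms(1), of y] assms(2) by linarith
qed simp

lemma walk_parity:
  assumes "walk c d w" "c \<le> x" "x \<le> d"
  shows "even (x + w x) \<longleftrightarrow> even (c + w c)"
  using assms(2,3)
proof (induction x rule: int_ge_induct)
  case (step x)
  then show ?case using walk_step[OF assms(1), of x] by auto
qed simp

definition valley :: "(int \<Rightarrow> int) \<Rightarrow> int \<Rightarrow> bool" where
  "valley w x \<longleftrightarrow> w (x - 1) = w x + 1 \<and> w (x + 1) = w x + 1"

text \<open>Only the abscissas are confined to \<open>I\<close>; the neighbours of a valley may lie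
  outside. A half-open interval can thus keep or drop a valley at one of its ends.\<close>

definition turns :: "lpoint set \<Rightarrow> (int \<Rightarrow> int) \<Rightarrow> int set \<Rightarrow> int set" where
  "turns Q w I = {x \<in> I. valley w x \<and> (x, w x) \<notin> Q}"

section \<open>Charging valleys to steps\<close>

lemma finite_turns: "finite I \<Longrightarrow> finite (turns Q w I)"
  by (simp add: turns_def)

lemma card_turns_mono: "I \<subseteq> J \<Longrightarrow> finite J \<Longrightarrow> card (turns Q w I) \<le> card (turns Q w J)"
  by (rule card_mono) (auto simp: turns_def)

lemma card_turns_subadd:
  assumes "K \<subseteq> I \<union> J" "finite I" "finite J"
  shows "card (turns Q w K) \<le> card (turns Q w I) + card (turns Q w J)"
proof -
  have "card (turns Q w K) \<le> card (turns Q w I \<union> turns Q w J)"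
    using assms by (intro card_mono) (auto simp: turns_def)
  then show ?thesis
    using card_Un_le[of "turns Q w I" "turns Q w J"] by linarith
qed

lemma card_turns_superadd:
  assumes "I \<union> J \<subseteq> K" "I \<inter> J = {}" "finite K"
  shows "card (turns Q w I) + card (turns Q w J) \<le> card (turns Q w K)"
proof -
  have "finite I" "finite J"
    using assms finite_subset by auto
  then have "card (turns Q w I) + card (turns Q w J) = card (turns Q w I \<union> turns Q w J)"
    using assms(2) by (intro card_Un_disjoint[symmetric]) (auto simp: turns_def)
  also have "\<dots> \<le> card (turns Q w K)"
    using assms by (intro card_mono) (auto simp: turns_def)
  finally show ?thesis .
qed

text \<open>The right-hand side is twice the number of down-steps on \<open>[c, d]\<close>, and each
  valley in \<open>{c<..d}\<close> is the end of a down-step of its own.\<close>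

lemma card_turns_le_down_steps:
  assumes "walk c d w" "c \<le> d"
  shows "2 * int (card (turns Q w {c<..d})) \<le> (d - c) - (w d - w c)"
proof -
  have "c \<le> d' \<Longrightarrow> d' \<le> d \<Longrightarrow> 2 * int (card (turns Q w {c<..d'})) \<le> (d' - c) - (w d' - w c)" for d'
  proof (induction d' rule: int_ge_induct)
    case base
    then show ?case by (simp add: turns_def)
  next
    case (step x)
    have "{c<..x + 1} \<subseteq> {c<..x} \<union> {x + 1}" by auto
    then have *: "card (turns Q w {c<..x + 1}) \<le> card (turns Q w {c<..x}) + card (turns Q w {x + 1})"
      by (rule card_turns_subadd) auto
    consider "w (x + 1) = w x + 1" | "w (x + 1) = w x - 1"
      using walk_step[OF assms(1)] step by force
    then show ?case
    proof cases
      case 1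
      then have "turns Q w {x + 1} = {}" by (auto simp: turns_def valley_def)
      with * 1 step show ?thesis by simp
    next
      case 2
      have "card (turns Q w {x + 1}) \<le> card {x + 1}"
        by (intro card_mono) (auto simp: turns_def)
      with * 2 step show ?thesis by simp
    qed
  qed
  then show ?thesis using assms by simp
qed

text \<open>Mirror image: each valley in \<open>{c..<d}\<close> is the start of an up-step of its
  own.\<close>

lemma card_turns_le_up_steps:
  assumes "walk c d w" "c \<le> d"
  shows "2 * int (card (turns Q w {c..<d})) \<le> (d - c) + (w d - w c)"
proof -
  have "c \<le> d' \<Longrightarrow> d' \<le> d \<Longrightarrow> 2 * int (card (turns Q w {c..<d'})) \<le> (d' - c) + (w d' - w c)" for d'
  proof (induction d' rule: int_ge_induct)
    case base
    then show ?case by (simp add: turns_def)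
  next
    case (step x)
    have "{c..<x + 1} \<subseteq> {c..<x} \<union> {x}" by auto
    then have *: "card (turns Q w {c..<x + 1}) \<le> card (turns Q w {c..<x}) + card (turns Q w {x})"
      by (rule card_turns_subadd) auto
    consider "w (x + 1) = w x + 1" | "w (x + 1) = w x - 1"
      using walk_step[OF assms(1)] step by force
    then show ?case
    proof cases
      case 1
      have "card (turns Q w {x}) \<le> card {x}"
        by (intro card_mono) (auto simp: turns_def)
      with * 1 step show ?thesis by simp
    next
      case 2
      then have "turns Q w {x} = {}" by (auto simp: turns_def valley_def)
      with * 2 step show ?thesis by simp
    qed
  qed
  then show ?thesis using assms by simp
qed

section \<open>The slalom value\<close>

text \<open>The slalom summand, rewritten: twice the number of steps of the rarer kind on any walk
  from \<open>C\<close> to \<open>D\<close>.\<close>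

definition min_steps :: "lpoint \<Rightarrow> lpoint \<Rightarrow> int" where
  "min_steps C D = (fst D - fst C) - \<bar>snd D - snd C\<bar>"

fun scan_value :: "lpoint \<Rightarrow> (slalom_label \<times> lpoint) list \<Rightarrow> lpoint \<Rightarrow> int" where
  "scan_value C [] b = min_steps C b"
| "scan_value C ((m, u) # U) b =
     (if turns_at m C u then min_steps C u + scan_value u U b else scan_value C U b)"

lemma min_steps_add:
  "turns_at m C D \<Longrightarrow> turns_at m D E \<Longrightarrow> min_steps C E = min_steps C D + min_steps D E"
  by (cases m) (auto simp: min_steps_def)

lemma slalom_value_snoc:
  "slalom_value (V @ [C, D]) = slalom_value (V @ [C]) + min_steps C D / 2"
proof -
  have nth: "(V @ [C, D]) ! i = (V @ [C]) ! i" if "i \<le> length V" for i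
    using that by (auto simp: nth_append)
  have last: "(V @ [C, D]) ! Suc (length V) = D"
    by (simp add: nth_append)
  have "min_steps C D = min (fst D + snd D - fst C - snd C) (fst D - snd D - fst C + snd C)"
    by (auto simp: min_steps_def)
  then show ?thesis
    using nth last by (simp add: slalom_value_def field_simps)
qed

text \<open>\<open>P\<close> is settled, while \<open>C\<close> may still be replaced. The invariant
  \<open>turns_at l P C\<close> says that \<open>C\<close> was reached in the direction of its
  label, which is what \<open>min_steps_add\<close> needs when a replacement occurs.\<close>

lemma slalom_value_scan:
  assumes "turns_at l P C"
  shows "slalom_value (slalom_scan (V @ [P]) l C U b) =
    slalom_value (V @ [P]) + (min_steps P C + scan_value C U b) / 2"
  using assms
proof (induction U arbitrary: V P l C)
  case Nil
  show ?case
  proof (cases "turns_at l C b")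
    case True
    then show ?thesis
      using Nil min_steps_add[of l P C b] by (simp add: slalom_value_snoc)
  next
    case False
    then show ?thesis
      using slalom_value_snoc[of "V @ [P]" C b] slalom_value_snoc[of V P C]
      by (simp add: field_simps)
  qed
next
  case (Cons h U)
  obtain m u where h: "h = (m, u)" by (cases h)
  show ?case
  proof (cases "turns_at m C u")
    case True
    show ?thesis
    proof (cases "m = l")
      case True
      \<comment> \<open>A further climb or descent beyond \<open>C\<close> is also one from
        \<open>P\<close>, so the invariant survives the replacement.\<close>
      have "turns_at l P u"
        using \<open>turns_at m C u\<close> True Cons.prems by (cases l) auto
      from Cons.IH[OF this] show ?thesis
        using min_steps_add[OF Cons.prems] h \<open>turns_at m C u\<close> True by simp
    next
      case False
      then show ?thesis
        using Cons.IH[OF True, of "V @ [P]"] slalom_value_snoc[of V P C] True h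
        by (simp add: field_simps)
    qed
  next
    case False
    then show ?thesis using Cons h by simp
  qed
qed

lemma slalom_value_points: "slalom_value (slalom_points C U b) = scan_value C U b / 2"
proof (induction C U b rule: slalom_points.induct)
  case (1 a b)
  show ?case using slalom_value_snoc[of "[]" a b] by (simp add: slalom_value_def)
next
  case (2 a m u U b)
  then show ?case using slalom_value_scan[of m a u "[]" U b] by (simp add: slalom_value_def)
qed

section \<open>Upper bound for a single walk\<close>

fun obeys :: "slalom_label \<Rightarrow> lpoint \<Rightarrow> (int \<Rightarrow> int) \<Rightarrow> bool" where
  "obeys S_label p w \<longleftrightarrow> snd p \<le> w (fst p)"
| "obeys T_label p w \<longleftrightarrow> w (fst p) \<le> snd p"

text \<open>
  On a rising stretch a valley is charged to its down-step, on a falling stretch to its up-step.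
  A valley at the abscissa of a \<open>T\<close>-point where the walk turns from falling to rising is charged to
  neither; it is excluded from the count unless the walk passes strictly below the point, and then
  the slack pays for it.
\<close>

lemma card_turns_le_scan_value:
  assumes "sorted (fst C # map (\<lambda>z. fst (snd z)) U @ [fst b])"
    and "\<And>m p. (m, p) \<in> set U \<Longrightarrow> obeys m p w"
    and "\<And>p. (T_label, p) \<in> set U \<Longrightarrow> p \<in> Q"
    and "walk (fst C) (fst b) w" and "w (fst b) = snd b"
  shows "(snd C \<le> w (fst C) \<longrightarrow>
      2 * int (card (turns Q w {fst C<..<fst b})) \<le> scan_value C U b + (w (fst C) - snd C)) \<and>
    (w (fst C) \<le> snd C \<and> C \<in> Q \<longrightarrow>
      2 * int (card (turns Q w {fst C..<fst b})) \<le> scan_value C U b + (snd C - w (fst C)))"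
  using assms
proof (induction U arbitrary: C)
  let ?N = "\<lambda>I. int (card (turns Q w I))"
  \<comment> \<open>Including the left end costs at most twice the slack below \<open>C\<close>:
    without slack a valley there lies on \<open>Q\<close>, and otherwise the slack is at least
    1.\<close>
  have start: "2 * ?N {fst C..d} \<le> 2 * ?N {fst C<..d} + 2 * (snd C - w (fst C))"
    if "w (fst C) \<le> snd C" "C \<in> Q" for C d
  proof (cases "w (fst C) = snd C")
    case True
    then have "turns Q w {fst C..d} \<subseteq> turns Q w {fst C<..d}"
      using that by (cases C) (auto simp: turns_def less_le)
    then show ?thesis
      using True card_mono[OF finite_turns] by force
  next
    case False
    have "?N {fst C..d} \<le> ?N {fst C} + ?N {fst C<..d}"
      using card_turns_subadd[of "{fst C..d}" "{fst C}" "{fst C<..d}" Q w] by force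
    moreover have "card (turns Q w {fst C}) \<le> card {fst C}"
      by (intro card_mono) (auto simp: turns_def)
    ultimately show ?thesis using False that by simp
  qed
  {
    case Nil
    let ?c = "fst C" and ?d = "fst b"
    have cd: "?c \<le> ?d" using Nil by simp
    note down = card_turns_le_down_steps[OF Nil(4) cd, of Q]
      and up = card_turns_le_up_steps[OF Nil(4) cd, of Q]
    have "?N {?c<..<?d} \<le> ?N {?c<..?d}" "?N {?c<..<?d} \<le> ?N {?c..<?d}" "?N {?c..<?d} \<le> ?N {?c..?d}"
      using card_turns_mono[of "{?c..<?d}" "{?c..?d}"] card_turns_mono[of "{?c<..<?d}" "{?c<..?d}"] card_turns_mono[of "{?c<..<?d}" "{?c..<?d}"]
      by force+
    then show ?case
      using down up start[of C ?d] Nil(5) by (auto simp: min_steps_def)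
  next
    case (Cons h U)
    obtain m D where h: "h = (m, D)" by (cases h)
    let ?c = "fst C" and ?d = "fst D" and ?e = "fst b"
    have cd: "?c \<le> ?d" and de: "?d \<le> ?e" and wcd: "walk ?c ?d w" and wde: "walk ?d ?e w"
      using Cons.prems(1,4) h by (auto intro: walk_subinterval)
    show ?case
    proof (cases "turns_at m C D")
      case False
      then show ?thesis
        using Cons.IH[of C] Cons.prems h by simp
    next
      case True
      note down = card_turns_le_down_steps[OF wcd cd, of Q]
        and up = card_turns_le_up_steps[OF wcd cd, of Q]
      have IH: "(snd D \<le> w ?d \<longrightarrow> 2 * ?N {?d<..<?e} \<le> scan_value D U b + (w ?d - snd D)) \<and>
        (w ?d \<le> snd D \<and> D \<in> Q \<longrightarrow> 2 * ?N {?d..<?e} \<le> scan_value D U b + (snd D - w ?d))"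
        using Cons.prems h wde by (intro Cons.IH) auto
      have D: "obeys m D w" "m = T_label \<Longrightarrow> D \<in> Q"
        using Cons.prems h by auto
      \<comment> \<open>A valley at the abscissa of \<open>D\<close> goes to the first part if
        \<open>D\<close> is an \<open>S\<close>-point, where the down-step entering it pays, and to
        the second part if \<open>D\<close> is a \<open>T\<close>-point, where the second half of
        the induction hypothesis covers it.\<close>
      have split: "?N {?c<..<?e} \<le> ?N {?c<..?d} + ?N {?d<..<?e}"
        "?N {?c<..<?e} \<le> ?N {?c..<?d} + ?N {?d..<?e}"
        "?N {?c..<?e} \<le> ?N {?c..<?d} + ?N {?d..<?e}"
        "?N {?c..<?e} \<le> ?N {?c..?d} + ?N {?d<..<?e}"
        unfolding of_nat_add[symmetric] of_nat_le_iff by (intro card_turns_subadd; force)+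
      show ?thesis
      proof (cases m)
        case S_label
        then show ?thesis
          using True D IH down up split start[of C ?d] h by (auto simp: min_steps_def)
      next
        case T_label
        then show ?thesis
          using True D IH down up split h by (auto simp: min_steps_def)
      qed
    qed
  }
qed

section \<open>Lazy walks\<close>

text \<open>\<open>L\<close> bounds walks from below and \<open>Q\<close> from above; valleys on
  \<open>Q\<close> will not count. The common parity means that a diagonal through a bound, if
  missed, is missed by at least two units.\<close>

locale course =
  fixes a b :: lpoint and L Q :: "lpoint set"
  assumes start_le_end: "fst a \<le> fst b"
    and even_start: "even (fst a + snd a)" and even_end: "even (fst b + snd b)"
    and in_range: "p \<in> L \<union> Q \<Longrightarrow> fst a \<le> fst p \<and> fst p \<le> fst b"
    and even_point: "p \<in> L \<union> Q \<Longrightarrow> even (fst p + snd p)"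
begin

definition feasible :: "(int \<Rightarrow> int) \<Rightarrow> bool" where
  "feasible w \<longleftrightarrow> walk (fst a) (fst b) w \<and> w (fst a) = snd a \<and> w (fst b) = snd b \<and>
     (\<forall>p\<in>L. snd p \<le> w (fst p)) \<and> (\<forall>q\<in>Q. w (fst q) \<le> snd q)"

text \<open>
  At abscissa \<open>u\<close> and height \<open>v\<close>, only a walk without down-steps can still reach the height
  required at some point with abscissa at least \<open>x\<close>; dually for \<open>must_fall\<close>.
\<close>

definition must_rise :: "int \<Rightarrow> int \<Rightarrow> int \<Rightarrow> bool" where
  "must_rise x u v \<longleftrightarrow> (\<exists>p\<in>insert b L. x \<le> fst p \<and> snd p - v = fst p - u)"

definition must_fall :: "int \<Rightarrow> int \<Rightarrow> int \<Rightarrow> bool" where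
  "must_fall x u v \<longleftrightarrow> (\<exists>q\<in>insert b Q. x \<le> fst q \<and> v - snd q = fst q - u)"

text \<open>The start is treated as if it had been entered by an up-step, so the zigzag opens with a
  down-step unless a rise is forced.\<close>

definition prefers_fall :: "(int \<Rightarrow> int) \<Rightarrow> int \<Rightarrow> bool" where
  "prefers_fall w u \<longleftrightarrow> u = fst a \<or> w (u - 1) = w u - 1 \<or> (u, w u) \<in> Q"

text \<open>
  A lazy walk zigzags below its current level and leaves it only when a restriction ahead forces it
  to. After falling to a \<open>T\<close>-point it falls once more if it can, since a valley at the
  \<open>T\<close>-point itself would not count.
\<close>

definition lazy_step :: "(int \<Rightarrow> int) \<Rightarrow> int \<Rightarrow> bool" where
  "lazy_step w u \<longleftrightarrow>
     (w (u + 1) = w u + 1 \<longrightarrow> must_rise (u + 1) u (w u) \<or> \<not> prefers_fall w u) \<and>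
     (w (u + 1) = w u - 1 \<longrightarrow> must_fall (u + 1) u (w u) \<or> prefers_fall w u)"

definition lazy :: "(int \<Rightarrow> int) \<Rightarrow> bool" where
  "lazy w \<longleftrightarrow> feasible w \<and> (\<forall>u. fst a \<le> u \<and> u < fst b \<longrightarrow> lazy_step w u)"

text \<open>Greedy construction from the left. The walk \<open>f\<close> serves to show that the
  bounds are compatible: having slope at most one, it proves that the start can reach each bound and
  that no point is forced both ways.\<close>

lemma lazy_exists:
  assumes "feasible f"
  shows "\<exists>w. lazy w"
proof -
  have f: "walk (fst a) (fst b) f" "f (fst a) = snd a" "f (fst b) = snd b"
    and fL: "\<And>p. p \<in> insert b L \<Longrightarrow> snd p \<le> f (fst p)"
    and fQ: "\<And>q. q \<in> insert b Q \<Longrightarrow> f (fst q) \<le> snd q"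
    using assms by (auto simp: feasible_def)
  have rng: "fst a \<le> fst p \<and> fst p \<le> fst b" "even (fst p + snd p)"
    if "p \<in> insert b L \<or> p \<in> insert b Q" for p
    using that in_range[of p] even_point[of p] start_le_end even_end by auto
  \<comment> \<open>\<open>I u v\<close>: the parity is right and each single bound ahead can still
    be met by a straight run. The end point \<open>b\<close> acts as both a lower and an upper
    bound.\<close>
  define I where "I u v \<longleftrightarrow> even (u + v) \<and>
      (\<forall>p\<in>insert b L. u \<le> fst p \<longrightarrow> snd p - v \<le> fst p - u) \<and>
      (\<forall>q\<in>insert b Q. u \<le> fst q \<longrightarrow> v - snd q \<le> fst q - u)" for u v
  have I_start: "I (fst a) (snd a)"
    unfolding I_def
  proof (intro conjI ballI impI)
    show "even (fst a + snd a)" by (rule even_start)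
  next
    fix p assume "p \<in> insert b L" "fst a \<le> fst p"
    then show "snd p - snd a \<le> fst p - fst a"
      using fL[of p] rng[of p] walk_lipschitz[OF f(1), of "fst a" "fst p"] f(2) by simp
  next
    fix q assume "q \<in> insert b Q" "fst a \<le> fst q"
    then show "snd a - snd q \<le> fst q - fst a"
      using fQ[of q] rng[of q] walk_lipschitz[OF f(1), of "fst a" "fst q"] f(2) by simp
  qed
  have I_rise: "I (u + 1) (v + 1)" if "I u v" "\<not> must_fall (u + 1) u v" for u v
    unfolding I_def
  proof (intro conjI ballI impI)
    show "even (u + 1 + (v + 1))" using that by (simp add: I_def)
  next
    fix p assume "p \<in> insert b L" "u + 1 \<le> fst p"
    then show "snd p - (v + 1) \<le> fst p - (u + 1)"
      using that(1) unfolding I_def by (smt (verit))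
  next
    fix q assume q: "q \<in> insert b Q" "u + 1 \<le> fst q"
    \<comment> \<open>An upper bound that is not tight leaves, by parity, two units of room, which
      is what an up-step uses.\<close>
    then have "v - snd q \<noteq> fst q - u" "v - snd q \<le> fst q - u" "even (u + v)" "even (fst q + snd q)"
      using that rng(2)[of q] unfolding I_def must_fall_def by auto
    then show "v + 1 - snd q \<le> fst q - (u + 1)" by presburger
  qed
  have I_fall: "I (u + 1) (v - 1)" if "I u v" "\<not> must_rise (u + 1) u v" for u v
    unfolding I_def
  proof (intro conjI ballI impI)
    show "even (u + 1 + (v - 1))" using that by (simp add: I_def)
  next
    fix q assume "q \<in> insert b Q" "u + 1 \<le> fst q"
    then show "v - 1 - snd q \<le> fst q - (u + 1)"
      using that(1) unfolding I_def by (smt (verit))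
  next
    fix p assume p: "p \<in> insert b L" "u + 1 \<le> fst p"
    then have "snd p - v \<noteq> fst p - u" "snd p - v \<le> fst p - u" "even (u + v)" "even (fst p + snd p)"
      using that rng(2)[of p] unfolding I_def must_rise_def by auto
    then show "snd p - (v - 1) \<le> fst p - (u + 1)" by presburger
  qed
  \<comment> \<open>A bound \<open>p\<close> forcing a rise and a bound \<open>q\<close> forcing a
    fall differ in height by more than their horizontal distance, too much for \<open>f\<close> to
    respect both.\<close>
  have not_both: "\<not> (must_rise (u + 1) u v \<and> must_fall (u + 1) u v)" if "fst a \<le> u" for u v
  proof
    assume "must_rise (u + 1) u v \<and> must_fall (u + 1) u v"
    then obtain p q where p: "p \<in> insert b L" "u + 1 \<le> fst p" "snd p - v = fst p - u"
      and q: "q \<in> insert b Q" "u + 1 \<le> fst q" "v - snd q = fst q - u"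
      unfolding must_rise_def must_fall_def by blast
    show False
      using p q fL[of p] fQ[of q] rng[of p] rng[of q] walk_lipschitz[OF f(1), of "fst p" "fst q"]
        walk_lipschitz[OF f(1), of "fst q" "fst p"] by linarith
  qed
  have "\<exists>w. w (fst a) = snd a \<and> (\<forall>u. fst a \<le> u \<and> u \<le> e \<longrightarrow> I u (w u)) \<and> walk (fst a) e w \<and>
      (\<forall>u. fst a \<le> u \<and> u < e \<longrightarrow> lazy_step w u)" if "fst a \<le> e" for e
    using that
  proof (induction e rule: int_ge_induct)
    case base
    show ?case
      by (rule exI[of _ "\<lambda>_. snd a"]) (auto simp: I_start walk_def dest: order_antisym)
  next
    case (step e)
    then obtain w where w: "w (fst a) = snd a" "\<And>u. fst a \<le> u \<Longrightarrow> u \<le> e \<Longrightarrow> I u (w u)"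
      "walk (fst a) e w" "\<And>u. fst a \<le> u \<Longrightarrow> u < e \<Longrightarrow> lazy_step w u"
      by blast
    \<comment> \<open>Forced moves come first, then the inclination. The order of the first two
      tests is immaterial by \<open>not_both\<close>.\<close>
    define s :: int where "s = (if must_rise (e + 1) e (w e) then 1
      else if must_fall (e + 1) e (w e) \<or> prefers_fall w e then - 1 else 1)"
    define w' where "w' = w(e + 1 := w e + s)"
    have s: "s = 1 \<or> s = - 1" by (simp add: s_def)
    have w': "w' u = w u" if "u \<le> e" for u
      using that by (simp add: w'_def)
    have pf: "prefers_fall w' u \<longleftrightarrow> prefers_fall w u" if "u \<le> e" for u
      using that by (simp add: prefers_fall_def w')
    have "I (e + 1) (w e + s)"
      using I_rise[OF w(2)[of e]] I_fall[OF w(2)[of e]] not_both[of e "w e"] step(1)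
      by (auto simp: s_def)
    then have "I u (w' u)" if "fst a \<le> u" "u \<le> e + 1" for u
      using that w(2)[of u] by (cases "u = e + 1") (auto simp: w'_def)
    moreover have "walk (fst a) (e + 1) w'"
      using w(3) s unfolding walk_def by (auto simp: w'_def)
    moreover have "lazy_step w' u" if "fst a \<le> u" "u < e + 1" for u
    proof (cases "u = e")
      case True
      then show ?thesis
        using not_both[of e "w e"] step(1) unfolding lazy_step_def pf[OF order_refl] True
        by (auto simp: w'_def s_def)
    next
      case False
      then have "lazy_step w u" using that w(4) by simp
      then show ?thesis
        using False that pf[of u] by (simp add: lazy_step_def w')
    qed
    moreover have "w' (fst a) = snd a"
      using w(1) step(1) by (simp add: w')
    ultimately show ?case by blast
  qed
  from this[OF start_le_end] obtain w where w: "w (fst a) = snd a"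
    "\<And>u. fst a \<le> u \<Longrightarrow> u \<le> fst b \<Longrightarrow> I u (w u)" "walk (fst a) (fst b) w"
    "\<And>u. fst a \<le> u \<Longrightarrow> u < fst b \<Longrightarrow> lazy_step w u"
    by blast
  \<comment> \<open>At the abscissa of a bound, \<open>I\<close> reduces to the bound itself; the
    two bounds at \<open>b\<close> pin down the final value.\<close>
  have "snd p \<le> w (fst p)" if "p \<in> insert b L" for p
    using that w(2)[of "fst p"] rng[of p] unfolding I_def by force
  moreover have "w (fst q) \<le> snd q" if "q \<in> insert b Q" for q
    using that w(2)[of "fst q"] rng[of q] unfolding I_def by force
  ultimately show ?thesis
    unfolding lazy_def feasible_def using w by (metis insertCI order_antisym)
qed

section \<open>Optimality of lazy walks\<close>

lemma rise_straight:
  assumes "feasible w" "must_rise d u (w u)" "fst a \<le> u" "u \<le> x" "x \<le> d"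
  shows "w x = w u + (x - u)" and "must_rise d x (w x)"
proof -
  obtain p where p: "p \<in> insert b L" "d \<le> fst p" "snd p - w u = fst p - u"
    using assms(2) unfolding must_rise_def by blast
  have "snd p \<le> w (fst p)" "fst p \<le> fst b" "walk (fst a) (fst b) w"
    using p(1) assms(1) in_range[of p] by (auto simp: feasible_def)
  \<comment> \<open>To meet the bound at \<open>p\<close> the walk must have slope one all the way
    from \<open>u\<close> to \<open>fst p\<close>.\<close>
  then show *: "w x = w u + (x - u)"
    using p assms walk_lipschitz[of "fst a" "fst b" w u x]
      walk_lipschitz[of "fst a" "fst b" w x "fst p"] by linarith
  show "must_rise d x (w x)"
    unfolding must_rise_def using p by (intro bexI[of _ p]) (auto simp: *)
qed

lemma fall_straight:
  assumes "feasible w" "must_fall d u (w u)" "fst a \<le> u" "u \<le> x" "x \<le> d"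
  shows "w x = w u - (x - u)" and "must_fall d x (w x)"
proof -
  obtain p where p: "p \<in> insert b Q" "d \<le> fst p" "w u - snd p = fst p - u"
    using assms(2) unfolding must_fall_def by blast
  have "w (fst p) \<le> snd p" "fst p \<le> fst b" "walk (fst a) (fst b) w"
    using p(1) assms(1) in_range[of p] by (auto simp: feasible_def)
  then show *: "w x = w u - (x - u)"
    using p assms walk_lipschitz[of "fst a" "fst b" w u x]
      walk_lipschitz[of "fst a" "fst b" w x "fst p"] by linarith
  show "must_fall d x (w x)"
    unfolding must_fall_def using p by (intro bexI[of _ p]) (auto simp: *)
qed

text \<open>No bound before \<open>d\<close> conflicts with level \<open>y\<close>, so the walk
  repeats down-up pairs, each with a valley at \<open>y - 1\<close>, until a bound at
  \<open>d\<close> or later takes over and the rest is straight. The second conjunct lists the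
  possible arrivals; \<open>y - 1\<close> arises when \<open>d\<close> cuts a pair in half.\<close>

lemma zigzag:
  assumes lazy: "lazy w" and "fst a \<le> c" "c \<le> d" "d \<le> fst b"
    and "w c = y" "prefers_fall w c"
    and "\<And>p. p \<in> L \<Longrightarrow> c \<le> fst p \<Longrightarrow> fst p < d \<Longrightarrow> snd p \<le> y"
    and "\<And>q. q \<in> Q \<Longrightarrow> c \<le> fst q \<Longrightarrow> fst q < d \<Longrightarrow> y \<le> snd q"
  shows "d - c - \<bar>w d - y\<bar> \<le> 2 * int (card (turns Q w {c<..<d})) \<and>
    (w d = y \<or> w d = y - 1 \<or> w d > y \<and> must_rise d d (w d) \<and> w (d - 1) = w d - 1 \<or>
     w d < y \<and> must_fall d d (w d))"
  using assms(2-)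
proof (induction "nat (d - c)" arbitrary: c rule: less_induct)
  case less
  have feas: "feasible w" and step: "\<And>u. fst a \<le> u \<Longrightarrow> u < fst b \<Longrightarrow> lazy_step w u"
    using lazy by (auto simp: lazy_def)
  have walk: "walk (fst a) (fst b) w" using feas by (simp add: feasible_def)
  note L = less.prems(6) and Q = less.prems(7)
  show ?case
  proof (cases "c = d")
    case True
    then show ?thesis using less.prems by simp
  next
    case False
    then have cd: "c < d" using less.prems by simp
    consider (U) "w (c + 1) = y + 1" | (D) "w (c + 1) = y - 1"
      using walk_step[OF walk, of c] less.prems cd by auto
    then show ?thesis
    proof cases
      case U
      then have "must_rise (c + 1) c (w c)"
        using step[of c] less.prems cd by (auto simp: lazy_step_def)
      \<comment> \<open>A bound forcing a rise from level \<open>y\<close> lies above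
        \<open>y\<close>, hence not before \<open>d\<close>.\<close>
      then have *: "must_rise d c (w c)"
        unfolding must_rise_def using L less.prems(3,4) by force
      note r = rise_straight[OF feas *]
      have "w d = y + (d - c)" "w (d - 1) = y + (d - 1 - c)"
        using r(1)[of d] r(1)[of "d - 1"] less.prems cd by auto
      then show ?thesis using r(2)[of d] less.prems cd by simp
    next
      case D
      show ?thesis
      proof (cases "c + 1 = d")
        case True
        then show ?thesis using D cd by simp
      next
        case False
        then have cd2: "c + 2 \<le> d" using cd by simp
        \<comment> \<open>This point is below \<open>y\<close> and before \<open>d\<close>, so it is
          not a \<open>T\<close>-point: a valley here counts, and the walk is not inclined to fall
          again.\<close>
        have nQ: "(c + 1, y - 1) \<notin> Q" using Q[of "(c + 1, y - 1)"] cd2 by auto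
        then have npf: "\<not> prefers_fall w (c + 1)"
          using less.prems D unfolding prefers_fall_def by auto
        consider (UU) "w (c + 2) = y" | (DD) "w (c + 2) = y - 2"
          using walk_step[OF walk, of "c + 1"] less.prems cd2 D by (auto simp: add.assoc)
        then show ?thesis
        proof cases
          case DD
          then have "must_fall (c + 2) (c + 1) (y - 1)"
            using step[of "c + 1"] less.prems cd2 npf D by (auto simp: lazy_step_def add.assoc)
          \<comment> \<open>The bound forcing the fall lies below \<open>y\<close>, hence at
            \<open>d\<close> or later.\<close>
          then have "must_fall d (c + 1) (w (c + 1))"
            unfolding must_fall_def D using Q less.prems(3) by force
          note r = fall_straight[OF feas this, of d]
          have "w d = y - (d - c)" using r(1) less.prems cd D by auto
          then show ?thesis using r(2) less.prems cd by simp
        next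
          case UU
          have pf: "prefers_fall w (c + 2)"
            unfolding prefers_fall_def using UU D by (simp add: add.commute)
          have IH: "d - (c + 2) - \<bar>w d - y\<bar> \<le> 2 * int (card (turns Q w {c + 2<..<d})) \<and>
            (w d = y \<or> w d = y - 1 \<or> w d > y \<and> must_rise d d (w d) \<and> w (d - 1) = w d - 1 \<or>
             w d < y \<and> must_fall d d (w d))"
            using less.prems cd2 UU pf by (intro less.hyps) auto
          have "turns Q w {c + 1} = {c + 1}"
            using UU D less.prems(4) nQ by (auto simp: turns_def valley_def add.commute)
          moreover have "card (turns Q w {c + 1}) + card (turns Q w {c + 2<..<d})
              \<le> card (turns Q w {c<..<d})"
            using cd2 by (intro card_turns_superadd) auto
          ultimately show ?thesis using IH by simp
        qed
      qed
    qed
  qed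
qed

text \<open>Stretch by stretch the lazy walk wastes no step. It may have overshot \<open>C\<close>,
  being forced further in the same direction; the overshoot is added on the left because the walk
  then continues straight. The assumptions on \<open>L\<close> and \<open>Q\<close> say that each
  bound ahead is unscanned or was passed over as compatible with the level of
  \<open>C\<close>.\<close>

lemma scan_value_le_card_turns:
  assumes lazy: "lazy w"
    and "sorted (fst C # map (\<lambda>z. fst (snd z)) U @ [fst b])" and "fst a \<le> fst C"
    and "set U \<subseteq> Pair S_label ` L \<union> Pair T_label ` Q"
    and "\<And>p. p \<in> L \<Longrightarrow> fst C \<le> fst p \<Longrightarrow>
      (S_label, p) \<in> set U \<or> snd p \<le> snd C \<and> (\<forall>z\<in>set U. fst p \<le> fst (snd z))"
    and "\<And>q. q \<in> Q \<Longrightarrow> fst C \<le> fst q \<Longrightarrow>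
      (T_label, q) \<in> set U \<or> snd C \<le> snd q \<and> (\<forall>z\<in>set U. fst q \<le> fst (snd z))"
    and "w (fst C) = snd C \<and> prefers_fall w (fst C) \<or>
      snd C < w (fst C) \<and> prefers_fall w (fst C) \<and> must_rise (fst C) (fst C) (w (fst C)) \<or>
      w (fst C) < snd C \<and> must_fall (fst C) (fst C) (w (fst C))"
  shows "scan_value C U b + \<bar>w (fst C) - snd C\<bar> \<le> 2 * int (card (turns Q w {fst C<..<fst b}))"
  using assms(2-)
proof (induction U arbitrary: C)
  have feas: "feasible w" using lazy by (simp add: lazy_def)
  then have walk: "walk (fst a) (fst b) w" and wb: "w (fst b) = snd b"
    and wL: "\<And>p. p \<in> L \<Longrightarrow> snd p \<le> w (fst p)" and wQ: "\<And>q. q \<in> Q \<Longrightarrow> w (fst q) \<le> snd q"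
    by (auto simp: feasible_def)
  \<comment> \<open>One stretch up to abscissa \<open>d\<close>. From the level of \<open>C\<close>
    this is \<open>zigzag\<close>; from an overshoot the walk runs straight and the left-hand side
    vanishes.\<close>
  have ahead: "d - fst C - \<bar>w d - snd C\<bar> + \<bar>w (fst C) - snd C\<bar> \<le> 2 * int (card (turns Q w {fst C<..<d})) \<and>
     (w d = snd C \<or> w d = snd C - 1 \<or>
      w d > snd C \<and> must_rise d d (w d) \<and> prefers_fall w d \<or> w d < snd C \<and> must_fall d d (w d))"
    if C: "fst a \<le> fst C" "fst C \<le> d" "d \<le> fst b"
      and L: "\<And>p. p \<in> L \<Longrightarrow> fst C \<le> fst p \<Longrightarrow> fst p < d \<Longrightarrow> snd p \<le> snd C"
      and Q: "\<And>q. q \<in> Q \<Longrightarrow> fst C \<le> fst q \<Longrightarrow> fst q < d \<Longrightarrow> snd C \<le> snd q"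
      and state: "w (fst C) = snd C \<and> prefers_fall w (fst C) \<or>
        snd C < w (fst C) \<and> prefers_fall w (fst C) \<and> must_rise (fst C) (fst C) (w (fst C)) \<or>
        w (fst C) < snd C \<and> must_fall (fst C) (fst C) (w (fst C))"
    for C d
    using state
  proof (elim disjE conjE)
    assume "w (fst C) = snd C" "prefers_fall w (fst C)"
    from zigzag[OF lazy C this L Q] this show ?thesis
      by (auto simp: prefers_fall_def)
  next
    assume *: "snd C < w (fst C)" "prefers_fall w (fst C)" "must_rise (fst C) (fst C) (w (fst C))"
    then have r: "must_rise d (fst C) (w (fst C))"
      unfolding must_rise_def using L C(2,3) by force
    note s = rise_straight[OF feas r C(1)]
    have "prefers_fall w d"
      using s(1)[of d] s(1)[of "d - 1"] C(2) *(2)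
      by (cases "fst C = d") (auto simp: prefers_fall_def)
    then show ?thesis using s(1,2)[of d] C(2) * by simp
  next
    assume *: "w (fst C) < snd C" "must_fall (fst C) (fst C) (w (fst C))"
    then have r: "must_fall d (fst C) (w (fst C))"
      unfolding must_fall_def using Q C(2,3) by force
    note s = fall_straight[OF feas r C(1)]
    show ?thesis using s(1,2)[of d] C(2) * by simp
  qed
  {
    case Nil
    have "fst C \<le> fst b" using Nil by simp
    from ahead[OF Nil(2) this order_refl] Nil(4-) show ?case
      by (simp add: min_steps_def wb)
  next
    case (Cons h U)
    obtain m D where h: "h = (m, D)" by (cases h)
    have CD: "fst C \<le> fst D" and Db: "fst D \<le> fst b"
      and DU: "\<And>z. z \<in> set U \<Longrightarrow> fst D \<le> fst (snd z)"
      and sorted: "sorted (fst D # map (\<lambda>z. fst (snd z)) U @ [fst b])"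
      using Cons.prems(1) h by auto
    note L = Cons.prems(4) and Q = Cons.prems(5)
    show ?case
    proof (cases "turns_at m C D")
      case False
      have "scan_value C U b + \<bar>w (fst C) - snd C\<bar> \<le> 2 * int (card (turns Q w {fst C<..<fst b}))"
      proof (rule Cons.IH)
        fix p assume p: "p \<in> L" "fst C \<le> fst p"
        show "(S_label, p) \<in> set U \<or> snd p \<le> snd C \<and> (\<forall>z\<in>set U. fst p \<le> fst (snd z))"
          using L[OF p] h False DU by auto
      next
        fix p assume p: "p \<in> Q" "fst C \<le> fst p"
        show "(T_label, p) \<in> set U \<or> snd C \<le> snd p \<and> (\<forall>z\<in>set U. fst p \<le> fst (snd z))"
          using Q[OF p] h False DU by auto
      qed (use Cons.prems in auto)
      then show ?thesis using False h by simp
    next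
      case True
      have D: "m = S_label \<and> D \<in> L \<and> snd D > snd C \<and> snd D \<le> w (fst D) \<or>
        m = T_label \<and> D \<in> Q \<and> snd D < snd C \<and> w (fst D) \<le> snd D"
        using True Cons.prems(3) h wL[of D] wQ[of D] by (cases m) auto
      have L': "snd p \<le> snd C" if "p \<in> L" "fst C \<le> fst p" "fst p < fst D" for p
        using L[OF that(1,2)] that(3) h DU[of "(S_label, p)"] by auto
      have Q': "snd C \<le> snd q" if "q \<in> Q" "fst C \<le> fst q" "fst q < fst D" for q
        using Q[OF that(1,2)] that(3) h DU[of "(T_label, q)"] by auto
      note A = ahead[OF Cons.prems(2) CD Db L' Q' Cons.prems(6)]
      have state: "w (fst D) = snd D \<and> prefers_fall w (fst D) \<or>
        snd D < w (fst D) \<and> prefers_fall w (fst D) \<and> must_rise (fst D) (fst D) (w (fst D)) \<or>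
        w (fst D) < snd D \<and> must_fall (fst D) (fst D) (w (fst D))"
      proof -
        \<comment> \<open>The clause on \<open>Q\<close> in \<open>prefers_fall\<close> covers a
          descent ending exactly on a \<open>T\<close>-point, from which the next zigzag
          starts.\<close>
        have "prefers_fall w (fst D)" if "D \<in> Q" "w (fst D) = snd D"
          using that by (simp add: prefers_fall_def)
        then show ?thesis using A D by linarith
      qed
      have "scan_value D U b + \<bar>w (fst D) - snd D\<bar> \<le> 2 * int (card (turns Q w {fst D<..<fst b}))"
      proof (rule Cons.IH)
        fix p assume p: "p \<in> L" "fst D \<le> fst p"
        show "(S_label, p) \<in> set U \<or> snd p \<le> snd D \<and> (\<forall>z\<in>set U. fst p \<le> fst (snd z))"
        proof -
          consider "(S_label, p) \<in> set U" | "p = D" |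
            "snd p \<le> snd C" "fst p \<le> fst D" "\<forall>z\<in>set U. fst p \<le> fst (snd z)"
            using L[of p] p CD h by auto
          then show ?thesis
          proof cases
            case 3
            \<comment> \<open>A tie in abscissa. \<open>p\<close> is no higher than
              \<open>C\<close>; if \<open>D\<close> is a \<open>T\<close>-point below
              \<open>C\<close>, the walk itself separates the two: it is at or above
              \<open>p\<close> and at or below \<open>D\<close>.\<close>
            then have "fst p = fst D" using p by simp
            then show ?thesis using 3 D wL[OF p(1)] by auto
          qed (use DU in auto)
        qed
      next
        fix p assume p: "p \<in> Q" "fst D \<le> fst p"
        show "(T_label, p) \<in> set U \<or> snd D \<le> snd p \<and> (\<forall>z\<in>set U. fst p \<le> fst (snd z))"
        proof -
          consider "(T_label, p) \<in> set U" | "p = D" |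
            "snd C \<le> snd p" "fst p \<le> fst D" "\<forall>z\<in>set U. fst p \<le> fst (snd z)"
            using Q[of p] p CD h by auto
          then show ?thesis
          proof cases
            case 3
            then have "fst p = fst D" using p by simp
            then show ?thesis using 3 D wQ[OF p(1)] by auto
          qed (use DU in auto)
        qed
      qed (use Cons.prems sorted CD state in auto)
      moreover have "card (turns Q w {fst C<..<fst D}) + card (turns Q w {fst D<..<fst b})
          \<le> card (turns Q w {fst C<..<fst b})"
        using CD Db by (intro card_turns_superadd) auto
      \<comment> \<open>The walk meets \<open>D\<close> or passes it on the side away from
        \<open>C\<close>, so its distance from the level of \<open>C\<close> splits at the level of
        \<open>D\<close>.\<close>
      ultimately show ?thesis
        using A D True h by (auto simp: min_steps_def)
    qed
  }
qed

definition scan_order :: "(slalom_label \<times> lpoint) list \<Rightarrow> bool" where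
  "scan_order U \<longleftrightarrow> sorted (fst a # map (\<lambda>z. fst (snd z)) U @ [fst b]) \<and>
     set U = Pair S_label ` L \<union> Pair T_label ` Q"

lemma card_turns_feasible_le:
  assumes "feasible w" "scan_order U"
  shows "2 * int (card (turns Q w {fst a<..<fst b})) \<le> scan_value a U b"
proof -
  have "obeys m p w" if "(m, p) \<in> set U" for m p
    using assms that by (cases m) (auto simp: feasible_def scan_order_def)
  moreover have "p \<in> Q" if "(T_label, p) \<in> set U" for p
    using assms that by (auto simp: scan_order_def)
  moreover have "walk (fst a) (fst b) w" "w (fst b) = snd b" "w (fst a) = snd a"
    using assms by (simp_all add: feasible_def)
  moreover have "sorted (fst a # map (\<lambda>z. fst (snd z)) U @ [fst b])"
    using assms by (simp add: scan_order_def)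
  ultimately show ?thesis
    using card_turns_le_scan_value[of a U b w Q] by fastforce
qed

text \<open>The left-hand side does not mention \<open>U\<close>: once a lazy walk exists, all ways
  of breaking ties give the same value.\<close>

lemma card_turns_lazy_eq:
  assumes "lazy w" "scan_order U"
  shows "2 * int (card (turns Q w {fst a<..<fst b})) = scan_value a U b"
proof (rule order_antisym)
  show "2 * int (card (turns Q w {fst a<..<fst b})) \<le> scan_value a U b"
    using assms card_turns_feasible_le by (simp add: lazy_def)
  have "scan_value a U b + \<bar>w (fst a) - snd a\<bar> \<le> 2 * int (card (turns Q w {fst a<..<fst b}))"
    using assms by (intro scan_value_le_card_turns)
      (auto simp: scan_order_def prefers_fall_def lazy_def feasible_def)
  then show "scan_value a U b \<le> 2 * int (card (turns Q w {fst a<..<fst b}))"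
    by simp
qed

end

text \<open>When the gap of 2 is first lost, the lower walk rises and the upper one falls. Neither
  is forced to, since the shift by \<open>(0, 2)\<close> carries bounds over. So the lower walk has
  just fallen and is not on \<open>Q\<close>, and the upper one, hence not on \<open>Q'\<close>, has
  just risen: one step earlier they would have met. The start clause of \<open>prefers_fall\<close>
  is excluded for the upper walk by \<open>fst a' < fst a\<close>.\<close>

lemma lazy_walks_ordered:
  assumes "course a b L Q" "course a' b' L' Q'"
    and "course.lazy a b L Q w" "course.lazy a' b' L' Q' w'"
    and "fst a' < fst a" "fst b \<le> fst b'"
    and L': "\<And>p. p \<in> insert a (insert b L) \<Longrightarrow> p + (0, 2) \<in> L'"
    and Q': "\<And>q. q \<in> Q \<longleftrightarrow> q + (0, 2) \<in> Q'"
    and "fst a \<le> u" "u \<le> fst b"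
  shows "w u + 2 \<le> w' u"
proof -
  interpret c: course a b L Q by fact
  interpret c': course a' b' L' Q' by fact
  have f: "c.feasible w" "c'.feasible w'" using assms(3,4) c.lazy_def c'.lazy_def by auto
  then have walk: "walk (fst a) (fst b) w" "walk (fst a') (fst b') w'"
    by (auto simp: c.feasible_def c'.feasible_def)
  have w'L: "snd p + 2 \<le> w' (fst p)" if "p \<in> insert a (insert b L)" for p
    using L'[OF that] f(2) unfolding c'.feasible_def by force
  have "\<forall>x\<in>{fst a..u}. w x + 2 \<le> w' x"
    using assms(9,10)
  proof (induction u rule: int_ge_induct)
    case base
    then show ?case using w'L[of a] f(1) by (simp add: c.feasible_def)
  next
    case (step u)
    have IH: "\<And>x. fst a \<le> x \<Longrightarrow> x \<le> u \<Longrightarrow> w x + 2 \<le> w' x" and u: "fst a \<le> u" "u < fst b"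
      using step by auto
    have "w (u + 1) + 2 \<le> w' (u + 1)"
    proof (rule ccontr)
      assume not: "\<not> w (u + 1) + 2 \<le> w' (u + 1)"
      have "even (u + w u)" "even (u + w' u)"
        using walk_parity[OF walk(1), of u] walk_parity[OF walk(2), of u] c.even_start c'.even_start
          f u assms(5,6) by (auto simp: c.feasible_def c'.feasible_def)
      then have "w' u = w u + 2 \<or> w' u \<ge> w u + 4" using IH[of u] u(1) by presburger
      then have eq: "w' u = w u + 2" and U: "w (u + 1) = w u + 1" and D: "w' (u + 1) = w' u - 1"
        using walk_step[OF walk(1) u] walk_step[OF walk(2), of u] u assms(5,6) not by auto
      have "\<not> c.must_rise (u + 1) u (w u)"
      proof
        assume "c.must_rise (u + 1) u (w u)"
        then obtain p where p: "p \<in> insert b L" "u + 1 \<le> fst p" "snd p - w u = fst p - u"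
          unfolding c.must_rise_def by blast
        then have "fst p \<le> fst b" using c.in_range[of p] by auto
        then show False
          using p w'L[of p] eq D walk_lipschitz[OF walk(2), of "u + 1" "fst p"] u assms(5,6) by auto
      qed
      then have npf: "\<not> c.prefers_fall w u"
        using assms(3) u U unfolding c.lazy_def c.lazy_step_def by blast
      have "\<not> c'.must_fall (u + 1) u (w' u)"
      proof
        assume "c'.must_fall (u + 1) u (w' u)"
        then obtain q where q: "q \<in> insert b' Q'" "u + 1 \<le> fst q" "w' u - snd q = fst q - u"
          unfolding c'.must_fall_def by blast
        show False
        proof (cases "q \<in> Q'")
          case True
          define r where "r = q - (0, 2)"
          have "r \<in> Q" using Q'[of r] True by (simp add: r_def)
          then have "w (fst q) \<le> snd q - 2" "fst q \<le> fst b"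
            using f(1) c.in_range[of r] unfolding c.feasible_def r_def by force+
          then show False
            using q eq U walk_lipschitz[OF walk(1), of "u + 1" "fst q"] u by auto
        next
          \<comment> \<open>Now \<open>q = b'\<close>, at or beyond \<open>fst b\<close>. Falling
            straight towards it would take \<open>w'\<close> below the bound
            \<open>b + (0, 2)\<close>.\<close>
          case False
          then have "c'.must_fall (fst b) u (w' u)"
            unfolding c'.must_fall_def using q assms(6) by auto
          then have "w' (fst b) = w' u - (fst b - u)"
            using c'.fall_straight(1)[OF f(2), of "fst b" u "fst b"] u assms(5) by auto
          then show False
            using w'L[of b] f(1) eq U walk_lipschitz[OF walk(1), of "u + 1" "fst b"] u
            by (auto simp: c.feasible_def)
        qed
      qed
      moreover have step': "c'.lazy_step w' u"
        using assms(4,5,6) u by (simp add: c'.lazy_def)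
      ultimately have pf: "c'.prefers_fall w' u"
        using D step' unfolding c'.lazy_step_def by blast
      have au: "fst a < u" and prev: "w (u - 1) \<noteq> w u - 1" and nQ: "(u, w u) \<notin> Q"
        using npf u(1) by (auto simp: c.prefers_fall_def)
      have "w (u - 1) = w u + 1"
        using walk_step[OF walk(1), of "u - 1"] au u prev by auto
      then have "w' (u - 1) \<noteq> w' u - 1"
        using IH[of "u - 1"] au eq by auto
      then show False
        using pf au assms(5) nQ Q'[of "(u, w u)"] eq by (auto simp: c'.prefers_fall_def)
    qed
    moreover have "x \<le> u \<or> x = u + 1" if "x \<le> u + 1" for x
      using that by auto
    ultimately show ?case using IH by (metis atLeastAtMost_iff)
  qed
  then show ?thesis using assms(9) by simp
qed

section \<open>Lattice paths as walks\<close>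

text \<open>The difference of the walks is even and changes by at most 2 per step, so they cannot
  cross without meeting.\<close>

lemma disjoint_walks_ordered:
  assumes "walk c d w" "walk c' d' w'" "c' \<le> c" "d \<le> d'"
    and "even (c + w c)" "even (c' + w' c')"
    and disj: "\<And>u. c \<le> u \<Longrightarrow> u \<le> d \<Longrightarrow> w u \<noteq> w' u" and "w c \<le> w' c"
    and "c \<le> u" "u \<le> d"
  shows "w u + 2 \<le> w' u"
proof -
  have gap: "w u + 2 \<le> w' u" if "w u \<le> w' u" "c \<le> u" "u \<le> d" for u
  proof -
    have "even (u + w u)" "even (u + w' u)"
      using walk_parity[OF assms(1), of u] walk_parity[OF assms(2), of u] assms that by auto
    with that disj[of u] show ?thesis by presburger
  qed
  show ?thesis
    using assms(9,10)
  proof (induction u rule: int_ge_induct)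
    case base
    then show ?case using gap assms(8) by simp
  next
    case (step u)
    then have "w (u + 1) \<le> w' (u + 1)"
      using walk_step[OF assms(1), of u] walk_step[OF assms(2), of u] assms(3,4) by auto
    then show ?case using gap step by simp
  qed
qed

text \<open>The open interval keeps both neighbours of a candidate valley inside
  \<open>[c, d]\<close>.\<close>

lemma turns_cong:
  assumes "\<And>u. c \<le> u \<Longrightarrow> u \<le> d \<Longrightarrow> w u = w' u"
  shows "turns Q w {c<..<d} = turns Q w' {c<..<d}"
  using assms unfolding turns_def valley_def by fastforce

section \<open>The height function of a lattice path\<close>

lemma rot_eq_iff [simp]: "rot x = rot y \<longleftrightarrow> x = y"
  by (cases x; cases y) (auto simp: rot_def)

lemma even_rot: "even (fst (rot x) + snd (rot x))"
  by (simp add: rot_def)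

text \<open>A path meets each antidiagonal between its ends exactly once, which gives the index. The
  value is meaningful only in that range.\<close>

definition height :: "lpoint list \<Rightarrow> int \<Rightarrow> int" where
  "height p u = snd (rot (p ! nat (u - fst (rot (hd p)))))"

context
  fixes p :: "lpoint list"
  assumes path: "lattice_path p"
begin

lemma path_step:
  "Suc k < length p \<Longrightarrow> p ! Suc k = p ! k + (1, 0) \<or> p ! Suc k = p ! k + (0, 1)"
  using path by (auto simp: lattice_path_def diff_eq_eq add.commute)

lemma fst_rot_nth: "k < length p \<Longrightarrow> fst (rot (p ! k)) = fst (rot (hd p)) + int k"
proof (induction k)
  case 0
  then show ?case by (simp add: hd_conv_nth)
next
  case (Suc k)
  then show ?case using path_step[of k] by (auto simp: rot_def)
qed

lemma fst_rot_last: "fst (rot (last p)) = fst (rot (hd p)) + int (length p) - 1"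
proof -
  have "p \<noteq> []" using path by (simp add: lattice_path_def)
  then have "0 < length p" "last p = p ! (length p - 1)" by (simp_all add: last_conv_nth)
  then show ?thesis using fst_rot_nth[of "length p - 1"] by (simp add: of_nat_diff Suc_leI)
qed

lemma rot_nth: "k < length p \<Longrightarrow> rot (p ! k) = (fst (rot (hd p)) + int k, height p (fst (rot (hd p)) + int k))"
  using fst_rot_nth[of k] by (simp add: height_def prod_eq_iff)

lemma rot_nth_height:
  assumes "fst (rot (hd p)) \<le> u" "u \<le> fst (rot (last p))"
  shows "rot (p ! nat (u - fst (rot (hd p)))) = (u, height p u)" "nat (u - fst (rot (hd p))) < length p"
  using assms rot_nth[of "nat (u - fst (rot (hd p)))"] fst_rot_last by auto

lemma mem_path_iff:
  "z \<in> set p \<longleftrightarrow> fst (rot (hd p)) \<le> fst (rot z) \<and> fst (rot z) \<le> fst (rot (last p)) \<and>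
     height p (fst (rot z)) = snd (rot z)"
proof
  assume "z \<in> set p"
  then obtain k where "k < length p" "z = p ! k" by (auto simp: in_set_conv_nth)
  then show "fst (rot (hd p)) \<le> fst (rot z) \<and> fst (rot z) \<le> fst (rot (last p)) \<and>
     height p (fst (rot z)) = snd (rot z)"
    using rot_nth[of k] fst_rot_last by simp
next
  assume *: "fst (rot (hd p)) \<le> fst (rot z) \<and> fst (rot z) \<le> fst (rot (last p)) \<and>
     height p (fst (rot z)) = snd (rot z)"
  then have "rot (p ! nat (fst (rot z) - fst (rot (hd p)))) = rot z"
    using rot_nth_height(1)[of "fst (rot z)"] by (simp add: prod_eq_iff)
  then show "z \<in> set p"
    using rot_nth_height(2)[of "fst (rot z)"] * nth_mem by fastforce
qed

lemma hd_last_in_path: "hd p \<in> set p" "last p \<in> set p"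
  using path by (auto simp: lattice_path_def)

lemma height_hd: "height p (fst (rot (hd p))) = snd (rot (hd p))"
  and height_last: "height p (fst (rot (last p))) = snd (rot (last p))"
  and hd_le_last: "fst (rot (hd p)) \<le> fst (rot (last p))"
  using hd_last_in_path mem_path_iff by blast+

lemma walk_height: "walk (fst (rot (hd p))) (fst (rot (last p))) (height p)"
  unfolding walk_def
proof (intro allI impI)
  fix u assume u: "fst (rot (hd p)) \<le> u \<and> u < fst (rot (last p))"
  define k where "k = nat (u - fst (rot (hd p)))"
  have "u = fst (rot (hd p)) + int k" "Suc k < length p"
    using u fst_rot_last by (auto simp: k_def)
  then show "\<bar>height p (u + 1) - height p u\<bar> = 1"
    using rot_nth[of k] rot_nth[of "Suc k"] path_step[of k] by (auto simp: rot_def algebra_simps)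
qed

text \<open>The point of the path on the antidiagonal of \<open>s\<close> decides: heights change by
  one per step, so this point keeps all others out of the forbidden quadrant.\<close>

lemma weakly_SE_of_iff:
  assumes "fst (rot (hd p)) \<le> fst (rot s)" "fst (rot s) \<le> fst (rot (last p))"
  shows "weakly_SE_of p s \<longleftrightarrow> snd (rot s) \<le> height p (fst (rot s))"
proof
  let ?z = "p ! nat (fst (rot s) - fst (rot (hd p)))"
  assume "weakly_SE_of p s"
  then have "fst ?z \<ge> fst s \<or> snd ?z \<le> snd s"
    using nth_mem[OF rot_nth_height(2)[OF assms]] by (auto simp: weakly_SE_of_def)
  then show "snd (rot s) \<le> height p (fst (rot s))"
    using rot_nth_height(1)[OF assms] by (auto simp: rot_def)
next
  assume s: "snd (rot s) \<le> height p (fst (rot s))"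
  have "fst s \<le> x \<or> y \<le> snd s" if "(x, y) \<in> set p" for x y
  proof (cases "x + y" "fst (rot s)" rule: le_cases)
    case le
    then show ?thesis
      using that s assms walk_lipschitz[OF walk_height, of "x + y" "fst (rot s)"]
      by (auto simp: mem_path_iff) (auto simp: rot_def)
  next
    case ge
    then show ?thesis
      using that s assms walk_lipschitz[OF walk_height, of "fst (rot s)" "x + y"]
      by (auto simp: mem_path_iff) (auto simp: rot_def)
  qed
  then show "weakly_SE_of p s" by (auto simp: weakly_SE_of_def)
qed

lemma weakly_NW_of_iff:
  assumes "fst (rot (hd p)) \<le> fst (rot s)" "fst (rot s) \<le> fst (rot (last p))"
  shows "weakly_NW_of p s \<longleftrightarrow> height p (fst (rot s)) \<le> snd (rot s)"
proof
  let ?z = "p ! nat (fst (rot s) - fst (rot (hd p)))"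
  assume "weakly_NW_of p s"
  then have "fst ?z \<le> fst s \<or> snd ?z \<ge> snd s"
    using nth_mem[OF rot_nth_height(2)[OF assms]] by (auto simp: weakly_NW_of_def)
  then show "height p (fst (rot s)) \<le> snd (rot s)"
    using rot_nth_height(1)[OF assms] by (auto simp: rot_def)
next
  assume s: "height p (fst (rot s)) \<le> snd (rot s)"
  have "x \<le> fst s \<or> snd s \<le> y" if "(x, y) \<in> set p" for x y
  proof (cases "x + y" "fst (rot s)" rule: le_cases)
    case le
    then show ?thesis
      using that s assms walk_lipschitz[OF walk_height, of "x + y" "fst (rot s)"]
      by (auto simp: mem_path_iff) (auto simp: rot_def)
  next
    case ge
    then show ?thesis
      using that s assms walk_lipschitz[OF walk_height, of "fst (rot s)" "x + y"]
      by (auto simp: mem_path_iff) (auto simp: rot_def)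
  qed
  then show "weakly_NW_of p s" by (auto simp: weakly_NW_of_def)
qed

text \<open>A NE-turn is determined by its antidiagonal and is never an end of the path, whence the
  open interval.\<close>

lemma card_NE_turns:
  "card (NE_turns p - Z) =
     card (turns (rot ` Z) (height p) {fst (rot (hd p))<..<fst (rot (last p))})"
proof (rule bij_betw_same_card[of "\<lambda>z. fst (rot z)"], rule bij_betw_imageI)
  have "NE_turns p \<subseteq> set p" by (auto simp: NE_turns_def)
  moreover have "inj_on (\<lambda>z. fst (rot z)) (set p)"
    by (rule inj_onI) (metis mem_path_iff prod_eq_iff rot_eq_iff)
  ultimately show "inj_on (\<lambda>z. fst (rot z)) (NE_turns p - Z)"
    by (meson Diff_subset inj_on_subset subset_trans)
next
  let ?a = "fst (rot (hd p))"
  have rot_Z: "(?a + int (Suc k), height p (?a + int (Suc k))) \<in> rot ` Z \<longleftrightarrow> p ! Suc k \<in> Z"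
    if "Suc k < length p" for k
    using rot_nth[OF that, symmetric] by auto
  have turn: "valley (height p) (?a + int (Suc k)) \<longleftrightarrow>
      p ! Suc k - p ! k = (0, 1) \<and> p ! Suc (Suc k) - p ! Suc k = (1, 0)"
    if "Suc (Suc k) < length p" for k
    using that rot_nth[of k] rot_nth[of "Suc k"] rot_nth[of "Suc (Suc k)"]
      path_step[of k] path_step[of "Suc k"]
    by (auto simp: valley_def rot_def prod_eq_iff algebra_simps)
  show "(\<lambda>z. fst (rot z)) ` (NE_turns p - Z) =
      turns (rot ` Z) (height p) {?a<..<fst (rot (last p))}" (is "?l = ?r")
  proof (intro equalityI subsetI)
    fix x assume "x \<in> ?l"
    then obtain k where k: "Suc (Suc k) < length p" "x = fst (rot (p ! Suc k))" "p ! Suc k \<notin> Z"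
      "p ! Suc k - p ! k = (0, 1) \<and> p ! Suc (Suc k) - p ! Suc k = (1, 0)"
      unfolding NE_turns_def by blast
    then have "x = ?a + int (Suc k)" using fst_rot_nth by simp
    with k turn[of k] rot_Z[of k] fst_rot_last show "x \<in> ?r"
      by (auto simp: turns_def)
  next
    fix x assume x: "x \<in> ?r"
    \<comment> \<open>A turn has index \<open>Suc k\<close> in \<open>NE_turns\<close>. As
      \<open>x\<close> exceeds the starting abscissa, the truncated subtraction is exact.\<close>
    define k where "k = nat (x - ?a) - 1"
    have xk: "x = ?a + int (Suc k)" and k: "Suc (Suc k) < length p"
      using x fst_rot_last by (auto simp: turns_def k_def)
    have "valley (height p) (?a + int (Suc k))" "p ! Suc k \<notin> Z"
      using x rot_Z[of k] k unfolding turns_def xk[symmetric] by auto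
    then have "p ! Suc k \<in> NE_turns p - Z"
      using turn[OF k] k unfolding NE_turns_def by blast
    then show "x \<in> ?l"
      using fst_rot_nth[of "Suc k"] k xk by force
  qed
qed

end

lemma path_of_walk:
  assumes "walk (fst (rot \<alpha>)) (fst (rot \<beta>)) w"
    and "w (fst (rot \<alpha>)) = snd (rot \<alpha>)" "w (fst (rot \<beta>)) = snd (rot \<beta>)"
    and "fst (rot \<alpha>) \<le> fst (rot \<beta>)"
  shows "\<exists>p. lattice_path p \<and> hd p = \<alpha> \<and> last p = \<beta> \<and>
    (\<forall>u. fst (rot \<alpha>) \<le> u \<and> u \<le> fst (rot \<beta>) \<longrightarrow> height p u = w u)"
proof -
  let ?a = "fst (rot \<alpha>)" and ?b = "fst (rot \<beta>)"
  \<comment> \<open>\<open>f\<close> inverts \<open>rot\<close>; the halves are exact because a walk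
    keeps the parity of rotated lattice points.\<close>
  define f where "f u = ((u + w u) div 2, (u - w u) div 2)" for u
  define p where "p = map f [?a..?b]"
  have rf: "rot (f u) = (u, w u)" if "?a \<le> u" "u \<le> ?b" for u
  proof -
    have "even (u + w u)"
      using walk_parity[OF assms(1) that] assms(2) even_rot[of \<alpha>] by simp
    then show ?thesis unfolding f_def rot_def by (auto elim!: evenE) presburger+
  qed
  have len: "int (length p) = ?b - ?a + 1" using assms(4) by (simp add: p_def)
  have nth: "p ! k = f (?a + int k)" if "k < length p" for k
    using that by (simp add: p_def nth_upto)
  have ne: "p \<noteq> []" using len assms(4) by auto
  have "rot (hd p) = rot \<alpha>"
    using ne assms rf[of ?a] nth[of 0] by (simp add: hd_conv_nth)
  then have hd: "hd p = \<alpha>" by simp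
  have "rot (last p) = rot \<beta>"
    using ne assms rf[of ?b] nth[of "length p - 1"] len
    by (simp add: last_conv_nth of_nat_diff Suc_leI)
  then have last: "last p = \<beta>" by simp
  have "lattice_path p"
    unfolding lattice_path_def
  proof (intro conjI allI impI ne)
    fix k assume k: "Suc k < length p"
    define u where "u = ?a + int k"
    have u: "?a \<le> u" "u < ?b" using k len by (auto simp: u_def)
    have "p ! k = f u" "p ! Suc k = f (u + 1)"
      using nth[of k] nth[of "Suc k"] k by (auto simp: u_def algebra_simps)
    moreover have "rot (f u) = (u, w u)" "rot (f (u + 1)) = (u + 1, w (u + 1))"
      using rf u by auto
    ultimately show "p ! Suc k - p ! k \<in> {(1, 0), (0, 1)}"
      using walk_step[OF assms(1) u] by (auto simp: rot_def prod_eq_iff)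
  qed
  moreover have "height p u = w u" if "?a \<le> u" "u \<le> ?b" for u
    unfolding height_def hd using that nth[of "nat (u - ?a)"] len rf[of u] by simp
  ultimately show ?thesis using hd last by blast
qed

text \<open>A slalom order can exist only if all restriction points lie between the antidiagonals of
  the two ends; this supplies \<open>in_range\<close>.\<close>

lemma course_of_slalom_order:
  assumes "slalom_order \<alpha> \<beta> Ss Ts U"
  shows "course (rot \<alpha>) (rot \<beta>) (rot ` Ss) (rot ` Ts)"
    and "course.scan_order (rot \<alpha>) (rot \<beta>) (rot ` Ss) (rot ` Ts) U"
proof -
  have sorted: "sorted (fst (rot \<alpha>) # map (\<lambda>z. fst (snd z)) U @ [fst (rot \<beta>)])"
    and set: "set U = Pair S_label ` rot ` Ss \<union> Pair T_label ` rot ` Ts"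
    using assms by (auto simp: slalom_order_def comp_def)
  have range: "fst (rot \<alpha>) \<le> fst p \<and> fst p \<le> fst (rot \<beta>)" if "p \<in> rot ` Ss \<union> rot ` Ts" for p
  proof -
    obtain m where "(m, p) \<in> set U" using \<open>p \<in> _\<close> set by blast
    then show ?thesis using sorted by (force simp: sorted_append)
  qed
  have le: "fst (rot \<alpha>) \<le> fst (rot \<beta>)" using sorted by simp
  have even: "even (fst p + snd p)" if "p \<in> rot ` Ss \<union> rot ` Ts" for p
    using that even_rot by blast
  show course: "course (rot \<alpha>) (rot \<beta>) (rot ` Ss) (rot ` Ts)"
    by (rule course.intro) (fact le even_rot range even)+
  show "course.scan_order (rot \<alpha>) (rot \<beta>) (rot ` Ss) (rot ` Ts) U"
    unfolding course.scan_order_def[OF course] using sorted set by simp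
qed

lemma feasible_height_iff:
  assumes course: "course (rot (hd p)) (rot (last p)) (rot ` Ss) (rot ` Ts)" and path: "lattice_path p"
  shows "course.feasible (rot (hd p)) (rot (last p)) (rot ` Ss) (rot ` Ts) (height p) \<longleftrightarrow>
    (\<forall>s\<in>Ss. weakly_SE_of p s) \<and> (\<forall>t\<in>Ts. weakly_NW_of p t)"
proof -
  interpret course "rot (hd p)" "rot (last p)" "rot ` Ss" "rot ` Ts" by fact
  have "weakly_SE_of p s \<longleftrightarrow> snd (rot s) \<le> height p (fst (rot s))" if "s \<in> Ss" for s
    using weakly_SE_of_iff[OF path] in_range[of "rot s"] that by simp
  moreover have "weakly_NW_of p s \<longleftrightarrow> height p (fst (rot s)) \<le> snd (rot s)" if "s \<in> Ts" for s
    using weakly_NW_of_iff[OF path] in_range[of "rot s"] that by simp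
  ultimately show ?thesis
    unfolding feasible_def using walk_height[OF path] height_hd[OF path] height_last[OF path] by simp
qed

section \<open>Families of paths\<close>

text \<open>The gaps of 2 add up because the intervals \<open>[c i, d i]\<close> grow with
  \<open>i\<close>, so \<open>u\<close> never leaves them.\<close>

lemma chain_ordered:
  fixes h :: "nat \<Rightarrow> int \<Rightarrow> int"
  assumes adj: "\<And>i u. 1 \<le> i \<Longrightarrow> i < n \<Longrightarrow> c i \<le> u \<Longrightarrow> u \<le> d i \<Longrightarrow> h i u + 2 \<le> h (Suc i) u"
    and c: "\<And>i. 1 \<le> i \<Longrightarrow> i < n \<Longrightarrow> c (Suc i) \<le> c i"
    and d: "\<And>i. 1 \<le> i \<Longrightarrow> i < n \<Longrightarrow> d i \<le> d (Suc i)"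
    and "1 \<le> i" "i \<le> j" "j \<le> n" "c i \<le> u" "u \<le> d i"
  shows "h i u + 2 * (int j - int i) \<le> h j u \<and> c j \<le> u \<and> u \<le> d j"
  using assms(5,6)
proof (induction j rule: dec_induct)
  case base
  then show ?case using assms by simp
next
  case (step j)
  then have "h i u + 2 * (int j - int i) \<le> h j u" "c j \<le> u" "u \<le> d j" "1 \<le> j" "j < n"
    using assms(4) by auto
  then show ?case using adj[of j u] c[of j] d[of j] by simp
qed

theorem theorem16:
  fixes A B :: int and n p q :: nat
    and a b :: "nat \<Rightarrow> int" and S T :: "nat \<Rightarrow> int \<times> int" and t :: "nat \<Rightarrow> real"
  assumes n: "n \<ge> 1"
    and a: "\<And>i j. 1 \<le> i \<Longrightarrow> i < j \<Longrightarrow> j \<le> n \<Longrightarrow> a i > a j"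
    and b: "\<And>i j. 1 \<le> i \<Longrightarrow> i < j \<Longrightarrow> j \<le> n \<Longrightarrow> b i > b j"
    and S: "\<And>k. k \<in> {1..p} \<Longrightarrow>
              0 \<le> fst (S k) \<and> fst (S k) \<le> B - b n \<and> a n \<le> snd (S k) \<and> snd (S k) \<le> A"
    and T: "\<And>j. j \<in> {1..q} \<Longrightarrow>
              0 \<le> fst (T j) \<and> fst (T j) \<le> B - b n \<and> a n \<le> snd (T j) \<and> snd (T j) \<le> A"
    and nonempty: "\<exists>P. path_family n (\<lambda>i. (0, a i)) (\<lambda>i. (B - b i, A)) (S ` {1..p}) (T ` {1..q}) P"
    and t: "\<And>i. i \<in> {1..n} \<Longrightarrow> slalom_output (0, a i) (B - b i, A)
              ({(int i - int j, a j - int i + int j) | j. 1 \<le> j \<and> j \<le> i - 1} \<union>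
               {(B - b j + int i - int j, A - int i + int j) | j. 1 \<le> j \<and> j \<le> i - 1} \<union>
               {S k + (int i - 1, - int i + 1) | k. 1 \<le> k \<and> k \<le> p})
              {T k + (- int n + int i, int n - int i) | k. 1 \<le> k \<and> k \<le> q}
              (t i)"
  shows "(\<exists>P. path_family n (\<lambda>i. (0, a i)) (\<lambda>i. (B - b i, A)) (S ` {1..p}) (T ` {1..q}) P \<and>
              real (counted_NE_turns n (T ` {1..q}) P) = (\<Sum>i=1..n. t i)) \<and>
         (\<forall>P. path_family n (\<lambda>i. (0, a i)) (\<lambda>i. (B - b i, A)) (S ` {1..p}) (T ` {1..q}) P \<longrightarrow>
              real (counted_NE_turns n (T ` {1..q}) P) \<le> (\<Sum>i=1..n. t i))"
proof -
  define \<alpha> where "\<alpha> i = (0 :: int, a i)" for i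
  define \<beta> where "\<beta> i = (B - b i, A)" for i
  define Ss where "Ss i = {(int i - int j, a j - int i + int j) | j. 1 \<le> j \<and> j \<le> i - 1} \<union>
    {(B - b j + int i - int j, A - int i + int j) | j. 1 \<le> j \<and> j \<le> i - 1} \<union>
    {S k + (int i - 1, - int i + 1) | k. 1 \<le> k \<and> k \<le> p}" for i
  define Ts where "Ts i = {T k + (- int n + int i, int n - int i) | k. 1 \<le> k \<and> k \<le> q}" for i
  \<comment> \<open>The antidiagonal of the end point; that of the starting point is
    \<open>a i\<close> itself.\<close>
  define e where "e i = B - b i + A" for i
  let ?fam = "path_family n \<alpha> \<beta> (S ` {1..p}) (T ` {1..q})"
  have rot_ends: "rot (\<alpha> i) = (a i, - a i)" "rot (\<beta> i) = (e i, B - b i - A)" for i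
    by (simp_all add: \<alpha>_def \<beta>_def e_def rot_def)
  have Ts_eq: "{x + (int i - int n, int n - int i) | x. x \<in> T ` {1..q}} = Ts i" for i
  proof -
    have "int i - int n = - int n + int i" by simp
    then show ?thesis
      unfolding Ts_def image_iff Bex_def atLeastAtMost_iff by metis
  qed

  have "\<exists>U. slalom_order (\<alpha> i) (\<beta> i) (Ss i) (Ts i) U \<and>
      t i = scan_value (rot (\<alpha> i)) U (rot (\<beta> i)) / 2" if "i \<in> {1..n}" for i
    using t[OF that] unfolding slalom_output_def slalom_value_points Ss_def Ts_def \<alpha>_def \<beta>_def .
  then obtain U where U: "\<And>i. i \<in> {1..n} \<Longrightarrow> slalom_order (\<alpha> i) (\<beta> i) (Ss i) (Ts i) (U i)"
    and tU: "\<And>i. i \<in> {1..n} \<Longrightarrow> t i = scan_value (rot (\<alpha> i)) (U i) (rot (\<beta> i)) / 2"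
    by metis
  note course = course_of_slalom_order(1)[OF U] and scan = course_of_slalom_order(2)[OF U]
  let ?feas = "\<lambda>i. course.feasible (rot (\<alpha> i)) (rot (\<beta> i)) (rot ` Ss i) (rot ` Ts i)"
  let ?lazy = "\<lambda>i. course.lazy (rot (\<alpha> i)) (rot (\<beta> i)) (rot ` Ss i) (rot ` Ts i)"
  have range: "a i \<le> fst (rot z) \<and> fst (rot z) \<le> e i" if "i \<in> {1..n}" "z \<in> Ss i \<union> Ts i" for i z
    using course.in_range[OF course[OF that(1)], of "rot z"] that(2) by (auto simp: rot_ends)
  have S_in: "S k + (int i - 1, - int i + 1) \<in> Ss i" if "k \<in> {1..p}" for i k
    using that by (auto simp: Ss_def)
  have T_in: "T k + (- int n + int i, int n - int i) \<in> Ts i" if "k \<in> {1..q}" for i k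
    using that by (auto simp: Ts_def)
  \<comment> \<open>The slalom shifts move points along their antidiagonals, so the original points
    are in range for every path as well.\<close>
  have S_range: "a i \<le> fst (rot (S k)) \<and> fst (rot (S k)) \<le> e i" if "i \<in> {1..n}" "k \<in> {1..p}" for i k
    using range[OF that(1) UnI1[OF S_in[OF that(2), of i]]] by (simp add: rot_def)
  have T_range: "a i \<le> fst (rot (T k)) \<and> fst (rot (T k)) \<le> e i" if "i \<in> {1..n}" "k \<in> {1..q}" for i k
    using range[OF that(1) UnI2[OF T_in[OF that(2), of i]]] by (simp add: rot_def)
  have a_Suc: "a (Suc i) < a i" and e_Suc: "e i < e (Suc i)" if "1 \<le> i" "i < n" for i
    using a[of i "Suc i"] b[of i "Suc i"] that by (auto simp: e_def)

  \<comment> \<open>Upper bound for every family\<close>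
  have family_feasible: "?feas i (height (P i))" if fam: "?fam P" and i: "i \<in> {1..n}" for P i
  proof -
    have P: "lattice_path (P i)" "hd (P i) = \<alpha> i" "last (P i) = \<beta> i"
      "\<And>s. s \<in> S ` {1..p} \<Longrightarrow> weakly_SE_of (P i) s" "\<And>t. t \<in> T ` {1..q} \<Longrightarrow> weakly_NW_of (P i) t"
      if "i \<in> {1..n}" for i
      using fam that by (auto simp: path_family_def)
    have disj: "set (P i) \<inter> set (P j) = {}" if "i \<in> {1..n}" "j \<in> {1..n}" "i \<noteq> j" for i j
      using fam that by (auto simp: path_family_def non_intersecting_def)
    have walk: "walk (a i) (e i) (height (P i))" and start: "height (P i) (a i) = - a i"
      and finish: "height (P i) (e i) = B - b i - A" and ae: "a i \<le> e i" if "i \<in> {1..n}" for i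
      using walk_height[OF P(1)[OF that]] height_hd[OF P(1)[OF that]] height_last[OF P(1)[OF that]]
        hd_le_last[OF P(1)[OF that]]
      unfolding P(2,3)[OF that] rot_ends by auto
    have adj: "height (P i) u + 2 \<le> height (P (Suc i)) u"
      if "1 \<le> i" "i < n" "a i \<le> u" "u \<le> e i" for i u
    proof (rule disjoint_walks_ordered[of "a i" "e i" "height (P i)" "a (Suc i)" "e (Suc i)" "height (P (Suc i))" u])
      have i: "i \<in> {1..n}" "Suc i \<in> {1..n}" using that by auto
      show "walk (a i) (e i) (height (P i))" "walk (a (Suc i)) (e (Suc i)) (height (P (Suc i)))"
        using walk i by auto
      show "a (Suc i) \<le> a i" "e i \<le> e (Suc i)" using a_Suc[OF that(1,2)] e_Suc[OF that(1,2)] by auto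
      show "even (a i + height (P i) (a i))" "even (a (Suc i) + height (P (Suc i)) (a (Suc i)))"
        using start i by auto
      \<comment> \<open>From its start at height \<open>- a (Suc i)\<close>, the next path can have
        dropped to \<open>- a i\<close> at the lowest.\<close>
      show "height (P i) (a i) \<le> height (P (Suc i)) (a i)"
        using walk_lipschitz[OF walk[OF i(2)], of "a (Suc i)" "a i"] start i
          a_Suc[OF that(1,2)] e_Suc[OF that(1,2)] ae[OF i(1)] by auto
      show "height (P i) u \<noteq> height (P (Suc i)) u" if u: "a i \<le> u" "u \<le> e i" for u
      proof
        assume eq: "height (P i) u = height (P (Suc i)) u"
        let ?z = "P i ! nat (u - a i)"
        have z: "rot ?z = (u, height (P i) u)"
          using rot_nth_height(1)[OF P(1)[OF i(1)]] u unfolding P(2,3)[OF i(1)] rot_ends by auto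
        then have "?z \<in> set (P i)" "?z \<in> set (P (Suc i))"
          using u eq a_Suc[OF \<open>1 \<le> i\<close> \<open>i < n\<close>] e_Suc[OF \<open>1 \<le> i\<close> \<open>i < n\<close>]
          unfolding mem_path_iff[OF P(1)[OF i(1)]] mem_path_iff[OF P(1)[OF i(2)]]
            P(2,3)[OF i(1)] P(2,3)[OF i(2)] rot_ends by auto
        then show False using disj[OF i] by auto
      qed
    qed (use that in auto)
    have ord: "height (P i) u + 2 * (int j - int i) \<le> height (P j) u \<and> a j \<le> u \<and> u \<le> e j"
      if "1 \<le> i" "i \<le> j" "j \<le> n" "a i \<le> u" "u \<le> e i" for i j u
      by (rule chain_ordered[of n a e "\<lambda>i. height (P i)"])
        (use adj a_Suc e_Suc that in \<open>auto intro: less_imp_le\<close>)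
    have "weakly_SE_of (P i) s" if s: "s \<in> Ss i" for s
    proof -
      have "snd (rot s) \<le> height (P i) (fst (rot s))"
        using s unfolding Ss_def
      proof (elim UnE CollectE exE conjE)
        \<comment> \<open>\<open>P i\<close> runs at least \<open>2 * (i - j)\<close> above
          \<open>P j\<close>; at the two ends of \<open>P j\<close> this yields the first two kinds
          of \<open>S\<close>-points.\<close>
        fix j assume j: "s = (int i - int j, a j - int i + int j)" "1 \<le> j" "j \<le> i - 1"
        then have "j \<le> i" "j \<in> {1..n}" using i by auto
        then show ?thesis
          using j ord[of j i "a j"] start[of j] ae[of j] i by (simp add: rot_def)
      next
        fix j assume j: "s = (B - b j + int i - int j, A - int i + int j)" "1 \<le> j" "j \<le> i - 1"
        then have "j \<le> i" "j \<in> {1..n}" using i by auto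
        then show ?thesis
          using j ord[of j i "e j"] finish[of j] ae[of j] i by (simp add: rot_def e_def algebra_simps)
      next
        \<comment> \<open>The spacing above \<open>P 1\<close> turns its bound at \<open>S k\<close>
          into the shifted one for \<open>P i\<close>.\<close>
        fix k assume k: "s = S k + (int i - 1, - int i + 1)" "1 \<le> k" "k \<le> p"
        have "snd (rot (S k)) \<le> height (P 1) (fst (rot (S k)))"
          using weakly_SE_of_iff[OF P(1)[of 1], of "S k"] P(2-4)[of 1] S_range[of 1 k] k n
          by (auto simp: rot_ends)
        then show ?thesis
          using ord[of 1 i "fst (rot (S k))"] S_range[of 1 k] k i n by (simp add: rot_def)
      qed
      then show ?thesis
        using weakly_SE_of_iff[OF P(1)[OF i], of s] range[OF i, of s] s P(2,3)[OF i]
        by (simp add: rot_ends)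
    qed
    moreover have "weakly_NW_of (P i) s" if s: "s \<in> Ts i" for s
    proof -
      obtain k where k: "s = T k + (- int n + int i, int n - int i)" "k \<in> {1..q}"
        using s by (auto simp: Ts_def)
      \<comment> \<open>Dually, the spacing below \<open>P n\<close> shifts the upper bound.\<close>
      have "height (P n) (fst (rot (T k))) \<le> snd (rot (T k))"
        using weakly_NW_of_iff[OF P(1)[of n], of "T k"] P(2,3,5)[of n] T_range[of n k] k n
        by (auto simp: rot_ends)
      then have "height (P i) (fst (rot s)) \<le> snd (rot s)"
        using ord[of i n "fst (rot (T k))"] T_range[of i k] k i n by (simp add: rot_def)
      then show ?thesis
        using weakly_NW_of_iff[OF P(1)[OF i], of s] range[OF i, of s] s P(2,3)[OF i]
        by (simp add: rot_ends)
    qed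
    ultimately show ?thesis
      using feasible_height_iff[of "P i" "Ss i" "Ts i"] P[OF i] course[OF i] by simp
  qed

  have card_eq: "card (NE_turns (P i) - Ts i) = card (turns (rot ` Ts i) (height (P i)) {a i<..<e i})"
    if "?fam P" "i \<in> {1..n}" for P i
  proof -
    have "lattice_path (P i)" "hd (P i) = \<alpha> i" "last (P i) = \<beta> i"
      using that by (auto simp: path_family_def)
    then show ?thesis using card_NE_turns[of "P i" "Ts i"] by (simp add: rot_ends)
  qed

  have upper: "real (counted_NE_turns n (T ` {1..q}) P) \<le> (\<Sum>i=1..n. t i)" if fam: "?fam P" for P
    unfolding counted_NE_turns_def Ts_eq of_nat_sum
  proof (rule sum_mono)
    fix i assume i: "i \<in> {1..n}"
    show "real (card (NE_turns (P i) - Ts i)) \<le> t i"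
      using course.card_turns_feasible_le[OF course[OF i] family_feasible[OF fam i] scan[OF i]]
      unfolding card_eq[OF fam i] tU[OF i] by (simp add: rot_ends)
  qed

  \<comment> \<open>Attainment by lazy walks\<close>
  obtain P0 where "?fam P0"
    using nonempty unfolding \<alpha>_def \<beta>_def by blast
  then have "\<exists>w. ?lazy i w" if "i \<in> {1..n}" for i
    using course.lazy_exists[OF course] family_feasible that by blast
  then obtain w where lazy: "\<And>i. i \<in> {1..n} \<Longrightarrow> ?lazy i (w i)" by metis
  have feas: "?feas i (w i)" if "i \<in> {1..n}" for i
    using lazy[OF that] course.lazy_def[OF course[OF that]] by blast
  have ae: "a i \<le> e i" if "i \<in> {1..n}" for i
    using course.start_le_end[OF course[OF that]] by (simp add: rot_ends)
  have w: "walk (a i) (e i) (w i)" "w i (a i) = - a i" "w i (e i) = B - b i - A"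
    "\<And>s. s \<in> Ss i \<Longrightarrow> snd (rot s) \<le> w i (fst (rot s))"
    "\<And>s. s \<in> Ts i \<Longrightarrow> w i (fst (rot s)) \<le> snd (rot s)" if "i \<in> {1..n}" for i
    using feas[OF that] unfolding course.feasible_def[OF course[OF that]] by (auto simp: rot_ends)
  have "\<exists>p. lattice_path p \<and> hd p = \<alpha> i \<and> last p = \<beta> i \<and>
      (\<forall>u. a i \<le> u \<and> u \<le> e i \<longrightarrow> height p u = w i u)" if "i \<in> {1..n}" for i
    using path_of_walk[of "\<alpha> i" "\<beta> i" "w i"] w[OF that] ae[OF that] by (simp add: rot_ends)
  then obtain P where P: "\<And>i. i \<in> {1..n} \<Longrightarrow> lattice_path (P i)"
    "\<And>i. i \<in> {1..n} \<Longrightarrow> hd (P i) = \<alpha> i" "\<And>i. i \<in> {1..n} \<Longrightarrow> last (P i) = \<beta> i"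
    and height: "\<And>i u. i \<in> {1..n} \<Longrightarrow> a i \<le> u \<Longrightarrow> u \<le> e i \<Longrightarrow> height (P i) u = w i u"
    by metis

  have adj: "w i u + 2 \<le> w (Suc i) u" if "1 \<le> i" "i < n" "a i \<le> u" "u \<le> e i" for i u
  proof -
    have i: "i \<in> {1..n}" "Suc i \<in> {1..n}" using that by auto
    \<comment> \<open>Passing from \<open>i\<close> to \<open>Suc i\<close> shifts restrictions by
      \<open>(1, -1)\<close>, that is, by 2 in height. The ends of path \<open>i\<close> become
      \<open>S\<close>-points of the next path, as \<open>lazy_walks_ordered\<close>
      requires.\<close>
    have shift: "rot z + (0, 2) = rot (z + (1, - 1))" for z
      by (simp add: rot_def prod_eq_iff)
    have "z + (1, - 1) \<in> Ss (Suc i)" if "z \<in> insert (\<alpha> i) (insert (\<beta> i) (Ss i))" for z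
      using that
    proof (elim insertE)
      assume "z = \<alpha> i"
      then have "z + (1, - 1) = (int (Suc i) - int i, a i - int (Suc i) + int i)"
        by (simp add: \<alpha>_def)
      then show ?thesis using \<open>1 \<le> i\<close> unfolding Ss_def by force
    next
      assume "z = \<beta> i"
      then have "z + (1, - 1) = (B - b i + int (Suc i) - int i, A - int (Suc i) + int i)"
        by (simp add: \<beta>_def)
      then show ?thesis using \<open>1 \<le> i\<close> unfolding Ss_def by force
    next
      assume "z \<in> Ss i"
      then consider j where "z = (int i - int j, a j - int i + int j)" "1 \<le> j" "j \<le> i - 1"
        | j where "z = (B - b j + int i - int j, A - int i + int j)" "1 \<le> j" "j \<le> i - 1"
        | k where "z = S k + (int i - 1, - int i + 1)" "k \<in> {1..p}"
        unfolding Ss_def by fastforce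
      then show ?thesis
      proof cases
        case 1
        then have "z + (1, - 1) = (int (Suc i) - int j, a j - int (Suc i) + int j)" by simp
        then show ?thesis using 1 unfolding Ss_def by force
      next
        case 2
        then have "z + (1, - 1) = (B - b j + int (Suc i) - int j, A - int (Suc i) + int j)" by simp
        then show ?thesis using 2 unfolding Ss_def by force
      next
        case 3
        then have "z + (1, - 1) = S k + (int (Suc i) - 1, - int (Suc i) + 1)"
          by (simp add: prod_eq_iff)
        then show ?thesis using S_in[OF 3(2), of "Suc i"] by simp
      qed
    qed
    then have L': "r + (0, 2) \<in> rot ` Ss (Suc i)"
      if "r \<in> insert (rot (\<alpha> i)) (insert (rot (\<beta> i)) (rot ` Ss i))" for r
      using that shift by blast
    have T_shift: "T k + (- int n + int i, int n - int i) + (1, - 1) =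
        T k + (- int n + int (Suc i), int n - int (Suc i))" for k
      by (simp add: prod_eq_iff)
    have Q': "r \<in> rot ` Ts i \<longleftrightarrow> r + (0, 2) \<in> rot ` Ts (Suc i)" for r
    proof
      assume "r \<in> rot ` Ts i"
      then obtain k where "r = rot (T k + (- int n + int i, int n - int i))" "k \<in> {1..q}"
        by (auto simp: Ts_def)
      then show "r + (0, 2) \<in> rot ` Ts (Suc i)"
        using T_in[of k "Suc i"] by (simp only: shift T_shift) blast
    next
      assume "r + (0, 2) \<in> rot ` Ts (Suc i)"
      then obtain k where k: "r + (0, 2) = rot (T k + (- int n + int (Suc i), int n - int (Suc i)))"
        "k \<in> {1..q}"
        by (auto simp: Ts_def)
      then have "r = rot (T k + (- int n + int i, int n - int i))"
        unfolding T_shift[symmetric] shift[symmetric] by (simp only: add_right_cancel)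
      then show "r \<in> rot ` Ts i" using T_in[OF k(2), of i] by blast
    qed
    show ?thesis
      by (rule lazy_walks_ordered[OF course[OF i(1)] course[OF i(2)] lazy[OF i(1)] lazy[OF i(2)] _ _ L' Q'])
        (use a_Suc[OF that(1,2)] e_Suc[OF that(1,2)] that in \<open>auto simp: rot_ends\<close>)
  qed
  have ord: "w i u + 2 * (int j - int i) \<le> w j u \<and> a j \<le> u \<and> u \<le> e j"
    if "1 \<le> i" "i \<le> j" "j \<le> n" "a i \<le> u" "u \<le> e i" for i j u
    by (rule chain_ordered[of n a e w])
      (use adj a_Suc e_Suc that in \<open>auto intro: less_imp_le\<close>)

  have "?fam P"
    unfolding path_family_def non_intersecting_def
  proof (intro conjI ballI impI)
    fix i s assume i: "i \<in> {1..n}" and "s \<in> S ` {1..p}"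
    then obtain k where k: "s = S k" "k \<in> {1..p}" by auto
    \<comment> \<open>The shifted lower bound is higher by \<open>2 * (i - 1)\<close> and hence
      implies the original one.\<close>
    have "snd (rot s) \<le> height (P i) (fst (rot s))"
      using w(4)[OF i S_in[OF k(2), of i]] S_range[OF i k(2)] height[OF i, of "fst (rot s)"] k i
      by (simp add: rot_def)
    then show "weakly_SE_of (P i) s"
      using weakly_SE_of_iff[OF P(1)[OF i], of s] S_range[OF i k(2)] k P(2,3)[OF i]
      by (simp add: rot_ends)
  next
    fix i s assume i: "i \<in> {1..n}" and "s \<in> T ` {1..q}"
    then obtain k where k: "s = T k" "k \<in> {1..q}" by auto
    \<comment> \<open>The shifted upper bound is lower by \<open>2 * (n - i)\<close> and hence
      implies the original one.\<close>
    have "height (P i) (fst (rot s)) \<le> snd (rot s)"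
      using w(5)[OF i T_in[OF k(2), of i]] T_range[OF i k(2)] height[OF i, of "fst (rot s)"] k i
      by (simp add: rot_def)
    then show "weakly_NW_of (P i) s"
      using weakly_NW_of_iff[OF P(1)[OF i], of s] T_range[OF i k(2)] k P(2,3)[OF i]
      by (simp add: rot_ends)
  next
    have "set (P i) \<inter> set (P j) = {}" if ij: "i \<in> {1..n}" "j \<in> {1..n}" "i < j" for i j
    proof -
      have False if z: "z \<in> set (P i)" "z \<in> set (P j)" for z
      proof -
        let ?u = "fst (rot z)"
        have "a i \<le> ?u" "?u \<le> e i" "height (P i) ?u = snd (rot z)"
          "a j \<le> ?u" "?u \<le> e j" "height (P j) ?u = snd (rot z)"
          using z unfolding mem_path_iff[OF P(1)[OF ij(1)]] mem_path_iff[OF P(1)[OF ij(2)]]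
            P(2,3)[OF ij(1)] P(2,3)[OF ij(2)] rot_ends by auto
        then show False
          using ord[of i j ?u] height[OF ij(1), of ?u] height[OF ij(2), of ?u] ij by simp
      qed
      then show ?thesis by blast
    qed
    then show "set (P i) \<inter> set (P j) = {}" if "i \<in> {1..n}" "j \<in> {1..n}" "i \<noteq> j" for i j
      using that by (metis Int_commute linorder_neqE_nat)
  qed (use P in auto)
  moreover have "real (counted_NE_turns n (T ` {1..q}) P) = (\<Sum>i=1..n. t i)"
    unfolding counted_NE_turns_def Ts_eq of_nat_sum
  proof (rule sum.cong[OF refl])
    fix i assume i: "i \<in> {1..n}"
    have "turns (rot ` Ts i) (height (P i)) {a i<..<e i} = turns (rot ` Ts i) (w i) {a i<..<e i}"
      using height[OF i] by (intro turns_cong)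
    moreover have "scan_value (rot (\<alpha> i)) (U i) (rot (\<beta> i)) =
        2 * int (card (turns (rot ` Ts i) (w i) {a i<..<e i}))"
      using course.card_turns_lazy_eq[OF course[OF i] lazy[OF i] scan[OF i]] by (simp add: rot_ends)
    ultimately show "real (card (NE_turns (P i) - Ts i)) = t i"
      unfolding card_eq[OF \<open>?fam P\<close> i] tU[OF i] by simp
  qed
  ultimately show ?thesis
    using upper unfolding \<alpha>_def \<beta>_def by blast
qed

end
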